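(* Let $A\,|\,B$ be a depth two ring extension, with centralizer $R=C_A(B)$ and $T=(A\otimes_B A)^B$. Then $R\otimes_T(A\otimes_B A)\cong A$ as $A$-$A$-bimodules, and $\mathrm{End}\,R_T\cong Z(A)$, where $Z(A)$ is the center of $A$.
   Context: Rings are associative and unital. A ring extension $A\,|\,B$ is a unital ring homomorphism $B\to A$, making $A$ a $B$-bimodule. For a $B$-bimodule $M$, $M^B=\{m\in M: bm=mb\ \forall b\in B\}$. The centralizer is $R=C_A(B)=A^B$. Elements $t\in T=(A\otimes_B A)^B$ are written $t=t^1\otimes t^2$ with a possible summation suppressed. $T$ is a ring with unit $1\otimes 1$ and multiplication $tt'={t'}^1t^1\otimes t^2{t'}^2$. $R$ is a right $T$-module via $r\cdot t=t^1rt^2$. $A\otimes_B A$ is a left $T$-module via $t\cdot(a\otimes a')=at^1\otimes t^2a'$; this commutes with its usual (outer) $A$-$A$-bimodule structure, which gives $R\otimes_T(A\otimes_B A)$ its $A$-$A$-bimodule structure. $M\oplus *\cong N$ means that $M$ is isomorphic to a direct summand of $N$. $A\,|\,B$ is depth two if there is a positive integer $n$ such that $A\otimes_B A\oplus *\cong A^n$ holds as natural $B$-$A$-bimodules (left depth two) and also as natural $A$-$B$-bimodules (right depth two). *)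

theory Defs
  imports "HOL-Algebra.Free_Abelian_Groups" "HOL-Algebra.QuotRing"
begin

section \<open>Bimodules\<close>

text \<open>
  As in the record \<open>module\<close> of HOL-Algebra, the additive group of a bimodule is stored in
  a ring record; its fields \<open>mult\<close> and \<open>one\<close> play no role for bimodules and are left
  \<open>undefined\<close> where the additive group is not taken from a ring.  Scalar rings need not be
  commutative.
\<close>

record ('l, 'm, 'r) bimodule = "'m ring" +
  lact :: "'l \<Rightarrow> 'm \<Rightarrow> 'm"
  ract :: "'m \<Rightarrow> 'r \<Rightarrow> 'm"

definition make_bimodule ::
  "('m, 'x) ring_scheme \<Rightarrow> ('l \<Rightarrow> 'm \<Rightarrow> 'm) \<Rightarrow> ('m \<Rightarrow> 'r \<Rightarrow> 'm) \<Rightarrow> ('l, 'm, 'r) bimodule"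
  where "make_bimodule M l r = ring.extend (ring.truncate M) (bimodule.fields l r)"

definition bimodule_hom ::
  "('l, 'x) ring_scheme \<Rightarrow> ('r, 'y) ring_scheme \<Rightarrow>
   ('l, 'm, 'r, 'u) bimodule_scheme \<Rightarrow> ('l, 'n, 'r, 'v) bimodule_scheme \<Rightarrow> ('m \<Rightarrow> 'n) set"
  where "bimodule_hom L R M N =
    {f \<in> carrier M \<rightarrow> carrier N.
       (\<forall>x\<in>carrier M. \<forall>y\<in>carrier M. f (x \<oplus>\<^bsub>M\<^esub> y) = f x \<oplus>\<^bsub>N\<^esub> f y) \<and>
       (\<forall>a\<in>carrier L. \<forall>x\<in>carrier M. f (lact M a x) = lact N a (f x)) \<and>
       (\<forall>x\<in>carrier M. \<forall>b\<in>carrier R. f (ract M x b) = ract N (f x) b)}"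

definition bimodule_isomorphic ::
  "('l, 'x) ring_scheme \<Rightarrow> ('r, 'y) ring_scheme \<Rightarrow>
   ('l, 'm, 'r, 'u) bimodule_scheme \<Rightarrow> ('l, 'n, 'r, 'v) bimodule_scheme \<Rightarrow> bool"
  where "bimodule_isomorphic L R M N \<longleftrightarrow>
    (\<exists>f \<in> bimodule_hom L R M N. bij_betw f (carrier M) (carrier N))"

definition sub_bimodule ::
  "('l, 'x) ring_scheme \<Rightarrow> ('r, 'y) ring_scheme \<Rightarrow> 'm set \<Rightarrow>
   ('l, 'm, 'r, 'u) bimodule_scheme \<Rightarrow> bool"
  where "sub_bimodule L R P M \<longleftrightarrow>
    subgroup P (add_monoid M) \<and>
    (\<forall>a\<in>carrier L. \<forall>x\<in>P. lact M a x \<in> P) \<and>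
    (\<forall>x\<in>P. \<forall>b\<in>carrier R. ract M x b \<in> P)"

text \<open>The relation \<open>M \<oplus> * \<cong> N\<close>:\<close>

definition iso_to_direct_summand ::
  "('l, 'x) ring_scheme \<Rightarrow> ('r, 'y) ring_scheme \<Rightarrow>
   ('l, 'm, 'r, 'u) bimodule_scheme \<Rightarrow> ('l, 'n, 'r, 'v) bimodule_scheme \<Rightarrow> bool"
  where "iso_to_direct_summand L R M N \<longleftrightarrow>
    (\<exists>P Q. sub_bimodule L R P N \<and> sub_bimodule L R Q N \<and>
       P \<inter> Q = {\<zero>\<^bsub>N\<^esub>} \<and> P <+>\<^bsub>N\<^esub> Q = carrier N \<and>
       bimodule_isomorphic L R M (N\<lparr>carrier := P\<rparr>))"

definition bimodule_power ::
  "('l, 'm, 'r, 'u) bimodule_scheme \<Rightarrow> nat \<Rightarrow> ('l, nat \<Rightarrow> 'm, 'r) bimodule"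
  where "bimodule_power M n =
    \<lparr>carrier = {..<n} \<rightarrow>\<^sub>E carrier M,
     monoid.mult = undefined,
     one = undefined,
     ring.zero = (\<lambda>i\<in>{..<n}. \<zero>\<^bsub>M\<^esub>),
     ring.add = (\<lambda>f g. \<lambda>i\<in>{..<n}. f i \<oplus>\<^bsub>M\<^esub> g i),
     lact = (\<lambda>a f. \<lambda>i\<in>{..<n}. lact M a (f i)),
     ract = (\<lambda>f b. \<lambda>i\<in>{..<n}. ract M (f i) b)\<rparr>"


section \<open>Balanced tensor products over a noncommutative ring\<close>

text \<open>
  In the following, \<open>M\<close> is a right module over \<open>S\<close> with action \<open>\<rho> :: 'm \<Rightarrow> 's \<Rightarrow> 'm\<close> and
  \<open>N\<close> is a left module over \<open>S\<close> with action \<open>\<mu> :: 's \<Rightarrow> 'n \<Rightarrow> 'n\<close>.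
\<close>

definition tensor_relations ::
  "('s, 'x) ring_scheme \<Rightarrow> ('m, 'u) ring_scheme \<Rightarrow> ('m \<Rightarrow> 's \<Rightarrow> 'm) \<Rightarrow>
   ('n, 'v) ring_scheme \<Rightarrow> ('s \<Rightarrow> 'n \<Rightarrow> 'n) \<Rightarrow> ('m \<times> 'n \<Rightarrow>\<^sub>0 int) set"
  where "tensor_relations S M \<rho> N \<mu> =
    {frag_of (x \<oplus>\<^bsub>M\<^esub> x', y) - frag_of (x, y) - frag_of (x', y) | x x' y.
       x \<in> carrier M \<and> x' \<in> carrier M \<and> y \<in> carrier N} \<union>
    {frag_of (x, y \<oplus>\<^bsub>N\<^esub> y') - frag_of (x, y) - frag_of (x, y') | x y y'.
       x \<in> carrier M \<and> y \<in> carrier N \<and> y' \<in> carrier N} \<union>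
    {frag_of (\<rho> x s, y) - frag_of (x, \<mu> s y) | x s y.
       x \<in> carrier M \<and> s \<in> carrier S \<and> y \<in> carrier N}"

definition tensor_subgroup ::
  "('s, 'x) ring_scheme \<Rightarrow> ('m, 'u) ring_scheme \<Rightarrow> ('m \<Rightarrow> 's \<Rightarrow> 'm) \<Rightarrow>
   ('n, 'v) ring_scheme \<Rightarrow> ('s \<Rightarrow> 'n \<Rightarrow> 'n) \<Rightarrow> ('m \<times> 'n \<Rightarrow>\<^sub>0 int) set"
  where "tensor_subgroup S M \<rho> N \<mu> =
    generate (free_Abelian_group (carrier M \<times> carrier N)) (tensor_relations S M \<rho> N \<mu>)"

definition tensor_product ::
  "('s, 'x) ring_scheme \<Rightarrow> ('m, 'u) ring_scheme \<Rightarrow> ('m \<Rightarrow> 's \<Rightarrow> 'm) \<Rightarrow>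
   ('n, 'v) ring_scheme \<Rightarrow> ('s \<Rightarrow> 'n \<Rightarrow> 'n) \<Rightarrow> ('m \<times> 'n \<Rightarrow>\<^sub>0 int) set ring"
  where "tensor_product S M \<rho> N \<mu> =
    (let Q = free_Abelian_group (carrier M \<times> carrier N) Mod tensor_subgroup S M \<rho> N \<mu>
     in \<lparr>carrier = carrier Q, monoid.mult = undefined, one = undefined,
         ring.zero = \<one>\<^bsub>Q\<^esub>, ring.add = monoid.mult Q\<rparr>)"

definition tensor_elem ::
  "('s, 'x) ring_scheme \<Rightarrow> ('m, 'u) ring_scheme \<Rightarrow> ('m \<Rightarrow> 's \<Rightarrow> 'm) \<Rightarrow>
   ('n, 'v) ring_scheme \<Rightarrow> ('s \<Rightarrow> 'n \<Rightarrow> 'n) \<Rightarrow> 'm \<Rightarrow> 'n \<Rightarrow> ('m \<times> 'n \<Rightarrow>\<^sub>0 int) set"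
  where "tensor_elem S M \<rho> N \<mu> x y =
    tensor_subgroup S M \<rho> N \<mu> #>\<^bsub>free_Abelian_group (carrier M \<times> carrier N)\<^esub> frag_of (x, y)"

text \<open>
  The additive map out of a tensor product induced by a balanced map \<open>\<beta>\<close> into the additive
  group of \<open>G\<close>.  An element \<open>C\<close> of the tensor product is a coset of formal sums; if \<open>\<beta>\<close> is
  balanced, then the linear extension of \<open>\<beta>\<close> is constant on this coset, and its single value
  is taken.
\<close>

definition tensor_lift ::
  "('g, 'z) ring_scheme \<Rightarrow> ('m \<Rightarrow> 'n \<Rightarrow> 'g) \<Rightarrow> ('m \<times> 'n \<Rightarrow>\<^sub>0 int) set \<Rightarrow> 'g"
  where "tensor_lift G \<beta> C =
    the_elem ((\<lambda>c. \<Oplus>\<^bsub>G\<^esub>p\<in>Poly_Mapping.keys c.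
                 add_pow G (Poly_Mapping.lookup c p) (\<beta> (fst p) (snd p))) ` C)"

text \<open>The endomorphism \<open>f \<otimes> g\<close> of \<open>M \<otimes>\<^sub>S N\<close>:\<close>

definition tensor_map ::
  "('s, 'x) ring_scheme \<Rightarrow> ('m, 'u) ring_scheme \<Rightarrow> ('m \<Rightarrow> 's \<Rightarrow> 'm) \<Rightarrow>
   ('n, 'v) ring_scheme \<Rightarrow> ('s \<Rightarrow> 'n \<Rightarrow> 'n) \<Rightarrow> ('m \<Rightarrow> 'm) \<Rightarrow> ('n \<Rightarrow> 'n) \<Rightarrow>
   ('m \<times> 'n \<Rightarrow>\<^sub>0 int) set \<Rightarrow> ('m \<times> 'n \<Rightarrow>\<^sub>0 int) set"
  where "tensor_map S M \<rho> N \<mu> f g =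
    tensor_lift (tensor_product S M \<rho> N \<mu>) (\<lambda>x y. tensor_elem S M \<rho> N \<mu> (f x) (g y))"


section \<open>Ring extensions\<close>

text \<open>
  A ring extension \<open>A | B\<close> is a unital homomorphism \<open>\<phi>\<close> from \<open>B\<close> to \<open>A\<close>, not necessarily
  injective.
\<close>

locale ring_extension = A?: ring A + B?: ring B
  for A :: "('a, 'x) ring_scheme" and B :: "('b, 'y) ring_scheme" and \<phi> :: "'b \<Rightarrow> 'a" +
  assumes hom: "\<phi> \<in> ring_hom B A"

text \<open>\<open>A\<close> as a bimodule, with scalars acting through ring homomorphisms \<open>\<sigma>\<close> and \<open>\<tau>\<close> into \<open>A\<close>:\<close>

definition regular_bimodule ::
  "('a, 'x) ring_scheme \<Rightarrow> ('l \<Rightarrow> 'a) \<Rightarrow> ('r \<Rightarrow> 'a) \<Rightarrow> ('l, 'a, 'r) bimodule"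
  where "regular_bimodule A \<sigma> \<tau> =
    make_bimodule A (\<lambda>l a. \<sigma> l \<otimes>\<^bsub>A\<^esub> a) (\<lambda>a r. a \<otimes>\<^bsub>A\<^esub> \<tau> r)"

text \<open>
  \<open>A \<otimes>\<^sub>B A\<close> with the outer actions \<open>l \<cdot> (a \<otimes> a') \<cdot> r = \<sigma>(l) a \<otimes> a' \<tau>(r)\<close>; the choices
  \<open>\<sigma>, \<tau> \<in> {id, \<phi>}\<close> give the natural bimodule structures over \<open>A\<close> and \<open>B\<close>.
\<close>

definition tensor_square ::
  "('a, 'x) ring_scheme \<Rightarrow> ('b, 'y) ring_scheme \<Rightarrow> ('b \<Rightarrow> 'a) \<Rightarrow> ('l \<Rightarrow> 'a) \<Rightarrow> ('r \<Rightarrow> 'a) \<Rightarrow>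
   ('l, ('a \<times> 'a \<Rightarrow>\<^sub>0 int) set, 'r) bimodule"
  where "tensor_square A B \<phi> \<sigma> \<tau> =
    (let \<rho> = (\<lambda>a b. a \<otimes>\<^bsub>A\<^esub> \<phi> b); \<mu> = (\<lambda>b a. \<phi> b \<otimes>\<^bsub>A\<^esub> a)
     in make_bimodule (tensor_product B A \<rho> A \<mu>)
          (\<lambda>l. tensor_map B A \<rho> A \<mu> (\<lambda>a. \<sigma> l \<otimes>\<^bsub>A\<^esub> a) id)
          (\<lambda>p r. tensor_map B A \<rho> A \<mu> id (\<lambda>a. a \<otimes>\<^bsub>A\<^esub> \<tau> r) p))"

definition depth_two ::
  "('a, 'x) ring_scheme \<Rightarrow> ('b, 'y) ring_scheme \<Rightarrow> ('b \<Rightarrow> 'a) \<Rightarrow> bool"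
  where "depth_two A B \<phi> \<longleftrightarrow>
    (\<exists>n>0.
       iso_to_direct_summand B A
         (tensor_square A B \<phi> \<phi> id) (bimodule_power (regular_bimodule A \<phi> id) n) \<and>
       iso_to_direct_summand A B
         (tensor_square A B \<phi> id \<phi>) (bimodule_power (regular_bimodule A id \<phi>) n))"

definition invariants ::
  "('b, 'y) ring_scheme \<Rightarrow> ('b, 'm, 'b, 'u) bimodule_scheme \<Rightarrow> 'm set"
  where "invariants B M = {m \<in> carrier M. \<forall>b\<in>carrier B. lact M b m = ract M m b}"

definition centralizer ::
  "('a, 'x) ring_scheme \<Rightarrow> ('b, 'y) ring_scheme \<Rightarrow> ('b \<Rightarrow> 'a) \<Rightarrow> ('a, 'x) ring_scheme"
  where "centralizer A B \<phi> = A\<lparr>carrier := invariants B (regular_bimodule A \<phi> \<phi>)\<rparr>"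

definition ring_center :: "('a, 'x) ring_scheme \<Rightarrow> ('a, 'x) ring_scheme"
  where "ring_center A =
    A\<lparr>carrier := {z \<in> carrier A. \<forall>a\<in>carrier A. z \<otimes>\<^bsub>A\<^esub> a = a \<otimes>\<^bsub>A\<^esub> z}\<rparr>"

text \<open>
  The action \<open>t \<cdot> (a \<otimes> a') = a t\<^sup>1 \<otimes> t\<^sup>2 a'\<close> of \<open>T\<close> on \<open>A \<otimes>\<^sub>B A\<close>.  The right-hand side is
  \<open>a \<cdot> t \<cdot> a'\<close> for the outer bimodule structure, which is balanced in \<open>(a, a')\<close> because
  \<open>t\<close> commutes with \<open>B\<close>.
\<close>

definition T_lact ::
  "('a, 'x) ring_scheme \<Rightarrow> ('b, 'y) ring_scheme \<Rightarrow> ('b \<Rightarrow> 'a) \<Rightarrow>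
   ('a \<times> 'a \<Rightarrow>\<^sub>0 int) set \<Rightarrow> ('a \<times> 'a \<Rightarrow>\<^sub>0 int) set \<Rightarrow> ('a \<times> 'a \<Rightarrow>\<^sub>0 int) set"
  where "T_lact A B \<phi> t =
    (let P = tensor_square A B \<phi> id id
     in tensor_lift P (\<lambda>a a'. lact P a (ract P t a')))"

text \<open>
  The multiplication \<open>t t' = t'\<^sup>1 t\<^sup>1 \<otimes> t\<^sup>2 t'\<^sup>2\<close> of \<open>T\<close> is the action of \<open>t\<close> on
  \<open>t' = t'\<^sup>1 \<otimes> t'\<^sup>2\<close>.
\<close>

definition T_ring ::
  "('a, 'x) ring_scheme \<Rightarrow> ('b, 'y) ring_scheme \<Rightarrow> ('b \<Rightarrow> 'a) \<Rightarrow> ('a \<times> 'a \<Rightarrow>\<^sub>0 int) set ring"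
  where "T_ring A B \<phi> =
    \<lparr>carrier = invariants B (tensor_square A B \<phi> \<phi> \<phi>),
     monoid.mult = T_lact A B \<phi>,
     one = tensor_elem B A (\<lambda>a b. a \<otimes>\<^bsub>A\<^esub> \<phi> b) A (\<lambda>b a. \<phi> b \<otimes>\<^bsub>A\<^esub> a) \<one>\<^bsub>A\<^esub> \<one>\<^bsub>A\<^esub>,
     ring.zero = \<zero>\<^bsub>tensor_square A B \<phi> \<phi> \<phi>\<^esub>,
     ring.add = ring.add (tensor_square A B \<phi> \<phi> \<phi>)\<rparr>"

text \<open>The action \<open>r \<cdot> t = t\<^sup>1 r t\<^sup>2\<close> of \<open>T\<close> on the centralizer:\<close>

definition T_ract :: "('a, 'x) ring_scheme \<Rightarrow> 'a \<Rightarrow> ('a \<times> 'a \<Rightarrow>\<^sub>0 int) set \<Rightarrow> 'a"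
  where "T_ract A r t = tensor_lift A (\<lambda>x y. x \<otimes>\<^bsub>A\<^esub> r \<otimes>\<^bsub>A\<^esub> y) t"

text \<open>\<open>R \<otimes>\<^sub>T (A \<otimes>\<^sub>B A)\<close> with \<open>a \<cdot> (r \<otimes> p) \<cdot> a' = r \<otimes> (a \<cdot> p \<cdot> a')\<close>:\<close>

definition centralizer_tensor ::
  "('a, 'x) ring_scheme \<Rightarrow> ('b, 'y) ring_scheme \<Rightarrow> ('b \<Rightarrow> 'a) \<Rightarrow>
   ('a, ('a \<times> ('a \<times> 'a \<Rightarrow>\<^sub>0 int) set \<Rightarrow>\<^sub>0 int) set, 'a) bimodule"
  where "centralizer_tensor A B \<phi> =
    (let R = centralizer A B \<phi>; T = T_ring A B \<phi>; P = tensor_square A B \<phi> id id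
     in make_bimodule (tensor_product T R (T_ract A) P (T_lact A B \<phi>))
          (\<lambda>a. tensor_map T R (T_ract A) P (T_lact A B \<phi>) id (lact P a))
          (\<lambda>q a. tensor_map T R (T_ract A) P (T_lact A B \<phi>) id (\<lambda>p. ract P p a) q))"

text \<open>
  The endomorphism ring of a right module.  Endomorphisms are extensional functions, so that
  two of them are equal as soon as they agree on the carrier.
\<close>

definition right_module_End ::
  "('s, 'x) ring_scheme \<Rightarrow> ('m, 'u) ring_scheme \<Rightarrow> ('m \<Rightarrow> 's \<Rightarrow> 'm) \<Rightarrow> ('m \<Rightarrow> 'm) ring"
  where "right_module_End S M \<rho> =
    \<lparr>carrier = {f \<in> carrier M \<rightarrow>\<^sub>E carrier M.
        (\<forall>x\<in>carrier M. \<forall>y\<in>carrier M. f (x \<oplus>\<^bsub>M\<^esub> y) = f x \<oplus>\<^bsub>M\<^esub> f y) \<and>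
        (\<forall>x\<in>carrier M. \<forall>s\<in>carrier S. f (\<rho> x s) = \<rho> (f x) s)},
     monoid.mult = (\<lambda>f g. compose (carrier M) f g),
     one = (\<lambda>x\<in>carrier M. x),
     ring.zero = (\<lambda>x\<in>carrier M. \<zero>\<^bsub>M\<^esub>),
     ring.add = (\<lambda>f g. \<lambda>x\<in>carrier M. f x \<oplus>\<^bsub>M\<^esub> g x)\<rparr>"

end

theory Submission
  imports Defs
begin

text \<open>
  Let \<open>f(r \<otimes> p) = p\<^sup>1 r p\<^sup>2\<close>; this is an \<open>A\<close>-\<open>A\<close>-bimodule map
  from \<open>R \<otimes>\<^sub>T (A \<otimes>\<^sub>B A)\<close> to \<open>A\<close>, and the claim is that
  \<open>a \<mapsto> 1 \<otimes> (1 \<otimes> a)\<close> is its inverse.  Left depth two, together with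
  \<open>Hom\<^sub>B\<^sub>-\<^sub>A(A, A \<otimes>\<^sub>B A) \<cong> T\<close>, writes every element of \<open>A \<otimes>\<^sub>B A\<close> as a
  finite sum \<open>\<Sum>\<^sub>i t\<^sub>i a\<^sub>i\<close> with \<open>t\<^sub>i \<in> T\<close>, \<open>a\<^sub>i \<in> A\<close>.  Since
  \<open>t a = t \<cdot> (1 \<otimes> a)\<close> and since \<open>1 \<otimes> r \<in> T\<close> acts by \<open>1 \<cdot> (1 \<otimes> r) = r\<close>, one gets
  \<open>r \<otimes> t a = (r \<cdot> t) \<otimes> (1 \<otimes> a) = 1 \<otimes> (1 \<otimes> (r \<cdot> t) a)\<close>.

  A \<open>T\<close>-endomorphism \<open>g\<close> of \<open>R\<close> is left multiplication by \<open>z = g(1)\<close>, because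
  \<open>g(r) = g(1 \<cdot> (1 \<otimes> r)) = z r\<close>.  It satisfies \<open>p\<^sup>1 z p\<^sup>2 = z p\<^sup>1 p\<^sup>2\<close> for \<open>p = t a\<close>,
  hence for all \<open>p\<close>, and \<open>p = a \<otimes> 1\<close> shows that \<open>z\<close> is central.
\<close>

section \<open>Balanced tensor products\<close>

text \<open>Phrasing additivity through the additive monoids makes the library results on
  \<open>hom\<close> and \<open>group_hom\<close> applicable.\<close>

definition additive_maps ::
  "('m, 'x) ring_scheme \<Rightarrow> ('n, 'y) ring_scheme \<Rightarrow> ('m \<Rightarrow> 'n) set"
  where "additive_maps M N = hom (add_monoid M) (add_monoid N)"

lemma additive_mapI:
  assumes "\<And>x. x \<in> carrier M \<Longrightarrow> f x \<in> carrier N"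
    and "\<And>x y. x \<in> carrier M \<Longrightarrow> y \<in> carrier M \<Longrightarrow> f (x \<oplus>\<^bsub>M\<^esub> y) = f x \<oplus>\<^bsub>N\<^esub> f y"
  shows "f \<in> additive_maps M N"
  using assms by (auto simp: additive_maps_def hom_def)

lemma additive_map_closed:
  "f \<in> additive_maps M N \<Longrightarrow> x \<in> carrier M \<Longrightarrow> f x \<in> carrier N"
  by (auto simp: additive_maps_def hom_def)

lemma additive_map_add:
  "f \<in> additive_maps M N \<Longrightarrow> x \<in> carrier M \<Longrightarrow> y \<in> carrier M \<Longrightarrow>
    f (x \<oplus>\<^bsub>M\<^esub> y) = f x \<oplus>\<^bsub>N\<^esub> f y"
  by (auto simp: additive_maps_def hom_def)

lemma additive_map_comp:
  "f \<in> additive_maps M N \<Longrightarrow> g \<in> additive_maps N Q \<Longrightarrow> (\<lambda>x. g (f x)) \<in> additive_maps M Q"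
  by (auto simp: additive_maps_def hom_def Pi_iff)

lemma additive_map_pointwise_add:
  assumes "abelian_group N" "f \<in> additive_maps M N" "g \<in> additive_maps M N"
  shows "(\<lambda>x. f x \<oplus>\<^bsub>N\<^esub> g x) \<in> additive_maps M N"
proof -
  interpret abelian_group N by fact
  show ?thesis
    using assms(2,3) by (auto simp: additive_maps_def hom_def a_ac Pi_def)
qed

lemma additive_map_zero:
  assumes "abelian_group M" "abelian_group N" "f \<in> additive_maps M N"
  shows "f \<zero>\<^bsub>M\<^esub> = \<zero>\<^bsub>N\<^esub>"
  using hom_one[OF assms(3)[unfolded additive_maps_def] abelian_group.a_group[OF assms(1)] abelian_group.a_group[OF assms(2)]]
  by simp

lemma additive_map_minus:
  assumes "abelian_group M" "abelian_group N" "f \<in> additive_maps M N" "x \<in> carrier M" "y \<in> carrier M"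
  shows "f (x \<ominus>\<^bsub>M\<^esub> y) = f x \<ominus>\<^bsub>N\<^esub> f y"
proof -
  interpret M: abelian_group M by fact
  interpret N: abelian_group N by fact
  interpret h: group_hom "add_monoid M" "add_monoid N" f
    by (intro group_hom.intro M.a_group N.a_group group_hom_axioms.intro
        assms(3)[unfolded additive_maps_def])
  show ?thesis
    using assms h.hom_inv[of y]
    by (simp add: M.minus_eq N.minus_eq additive_map_add[OF assms(3)] flip: a_inv_def)
qed

lemma additive_map_finsum:
  assumes "abelian_group M" "abelian_group N" "f \<in> additive_maps M N"
    and "finite I" "x \<in> I \<rightarrow> carrier M"
  shows "f (\<Oplus>\<^bsub>M\<^esub>i\<in>I. x i) = (\<Oplus>\<^bsub>N\<^esub>i\<in>I. f (x i))"
  using assms(4,5)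
proof (induction I rule: finite_induct)
  interpret M: abelian_group M by fact
  interpret N: abelian_group N by fact
  case empty
  then show ?case using additive_map_zero[OF assms(1-3)] by simp
next
  interpret M: abelian_group M by fact
  interpret N: abelian_group N by fact
  case (insert i I)
  then show ?case
    using assms(3) by (simp add: additive_map_add Pi_def additive_map_closed)
qed

definition balanced_map ::
  "('s, 'x) ring_scheme \<Rightarrow> ('m, 'u) ring_scheme \<Rightarrow> ('m \<Rightarrow> 's \<Rightarrow> 'm) \<Rightarrow>
   ('n, 'v) ring_scheme \<Rightarrow> ('s \<Rightarrow> 'n \<Rightarrow> 'n) \<Rightarrow> ('g, 'z) ring_scheme \<Rightarrow> ('m \<Rightarrow> 'n \<Rightarrow> 'g) \<Rightarrow> bool"
  where "balanced_map S M \<rho> N \<mu> G \<beta> \<longleftrightarrow>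
    (\<forall>x\<in>carrier M. \<beta> x \<in> additive_maps N G) \<and>
    (\<forall>y\<in>carrier N. (\<lambda>x. \<beta> x y) \<in> additive_maps M G) \<and>
    (\<forall>x\<in>carrier M. \<forall>s\<in>carrier S. \<forall>y\<in>carrier N. \<beta> (\<rho> x s) y = \<beta> x (\<mu> s y))"

text \<open>The universal property of the free abelian group on \<open>X\<close>: any function
  \<open>\<gamma>\<close> on the generators extends linearly. The formula for \<open>h\<close> is
  the one inside \<open>tensor_lift\<close>, so the extension can be matched with it
  directly.\<close>

lemma frag_sum_hom:
  assumes "abelian_group G" "\<And>p. p \<in> X \<Longrightarrow> \<gamma> p \<in> carrier G"
  defines "h \<equiv> \<lambda>c. \<Oplus>\<^bsub>G\<^esub>p\<in>Poly_Mapping.keys c. add_pow G (Poly_Mapping.lookup c p) (\<gamma> p)"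
  shows "h \<in> hom (free_Abelian_group X) (add_monoid G)"
    and "\<And>p. p \<in> X \<Longrightarrow> h (frag_of p) = \<gamma> p"
proof -
  interpret G: abelian_group G by fact
  \<comment> \<open>The supports of \<open>c\<close>, \<open>d\<close> and \<open>c + d\<close>
    differ. Enlarging the index set adds only zero terms, so all three sums can be taken over one
    common finite set.\<close>
  have ext: "h c = (\<Oplus>\<^bsub>G\<^esub>p\<in>I. add_pow G (Poly_Mapping.lookup c p) (\<gamma> p))"
    if "finite I" "Poly_Mapping.keys c \<subseteq> I" "I \<subseteq> X" for c I
    unfolding h_def
  proof (rule G.add.finprod_mono_neutral_cong_left)
    show "add_pow G (Poly_Mapping.lookup c p) (\<gamma> p) = \<zero>\<^bsub>G\<^esub>"
      if "p \<in> I - Poly_Mapping.keys c" for p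
      using that by (simp add: in_keys_iff add_pow_def)
  qed (use that assms(2) in auto)
  show "h \<in> hom (free_Abelian_group X) (add_monoid G)"
  proof (rule homI)
    fix c assume "c \<in> carrier (free_Abelian_group X)"
    then show "h c \<in> carrier (add_monoid G)"
      using assms(2) by (auto simp: h_def intro!: G.finsum_closed)
  next
    fix c d assume c: "c \<in> carrier (free_Abelian_group X)" and d: "d \<in> carrier (free_Abelian_group X)"
    let ?I = "Poly_Mapping.keys c \<union> Poly_Mapping.keys d"
    have I: "finite ?I" "?I \<subseteq> X" "Poly_Mapping.keys (c + d) \<subseteq> ?I"
      using c d keys_add[of c d] by auto
    have "h (c + d) = (\<Oplus>\<^bsub>G\<^esub>p\<in>?I. add_pow G (Poly_Mapping.lookup c p) (\<gamma> p) \<oplus>\<^bsub>G\<^esub>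
        add_pow G (Poly_Mapping.lookup d p) (\<gamma> p))"
      unfolding ext[OF I(1,3,2)]
      by (rule G.finsum_cong') (use I assms(2) in \<open>auto simp: lookup_add G.add.int_pow_mult subset_iff\<close>)
    also have "\<dots> = h c \<oplus>\<^bsub>G\<^esub> h d"
      using I assms(2) by (subst G.finsum_addf) (auto simp: ext[of ?I] subset_iff)
    finally show "h (c \<otimes>\<^bsub>free_Abelian_group X\<^esub> d) = h c \<otimes>\<^bsub>add_monoid G\<^esub> h d"
      by simp
  qed
  show "h (frag_of p) = \<gamma> p" if "p \<in> X" for p
    using assms(2)[OF that] by (subst ext[of "{p}"]) (use that in auto)
qed

text \<open>The two closure conditions place the balancing relations inside the free group. The
  locale is used twice: for the tensor square of \<open>A\<close> over \<open>B\<close>, and for the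
  tensor product of \<open>R\<close> with that square over \<open>T\<close>.\<close>

locale tensor_data = M: abelian_group M + N: abelian_group N
  for S :: "('s, 'x) ring_scheme" and M :: "('m, 'u) ring_scheme" and \<rho> :: "'m \<Rightarrow> 's \<Rightarrow> 'm"
    and N :: "('n, 'v) ring_scheme" and \<mu> :: "'s \<Rightarrow> 'n \<Rightarrow> 'n" +
  assumes rho_closed: "x \<in> carrier M \<Longrightarrow> s \<in> carrier S \<Longrightarrow> \<rho> x s \<in> carrier M"
    and mu_closed: "s \<in> carrier S \<Longrightarrow> y \<in> carrier N \<Longrightarrow> \<mu> s y \<in> carrier N"
begin

section \<open>The free abelian group modulo the balancing relations\<close>

abbreviation "F \<equiv> free_Abelian_group (carrier M \<times> carrier N)"
abbreviation "K \<equiv> tensor_subgroup S M \<rho> N \<mu>"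
abbreviation "tensor \<equiv> tensor_product S M \<rho> N \<mu>"
abbreviation "pure \<equiv> tensor_elem S M \<rho> N \<mu>"

lemma relations_subset: "tensor_relations S M \<rho> N \<mu> \<subseteq> carrier F"
proof -
  have *: "Poly_Mapping.keys (frag_of a - frag_of b) \<subseteq> X" if "a \<in> X" "b \<in> X"
    for a b :: "'m \<times> 'n" and X
    using that keys_diff[of "frag_of a" "frag_of b"] by auto
  have "Poly_Mapping.keys (frag_of a - frag_of b - frag_of c) \<subseteq> X" if "a \<in> X" "b \<in> X" "c \<in> X"
    for a b c :: "'m \<times> 'n" and X
    using that *[of a X b] keys_diff[of "frag_of a - frag_of b" "frag_of c"] by auto
  with * show ?thesis
    unfolding tensor_relations_def by (auto simp: rho_closed mu_closed simp del: keys_single)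
qed

lemma subgroup_K: "subgroup K F"
  unfolding tensor_subgroup_def
  by (rule group.generate_is_subgroup[OF group_free_Abelian_group relations_subset])

lemma normal_K: "K \<lhd> F"
  by (rule comm_group.subgroup_imp_normal[OF abelian_free_Abelian_group subgroup_K])

lemma carrier_tensor: "carrier tensor = carrier (F Mod K)"
  and add_tensor: "add_monoid tensor = F Mod K"
  by (simp_all add: tensor_product_def Let_def FactGroup_def)

lemma abelian_group_tensor: "abelian_group tensor"
proof (rule abelian_group.intro)
  have "comm_group (F Mod K)"
    by (rule comm_group.abelian_FactGroup[OF abelian_free_Abelian_group subgroup_K])
  then show "abelian_group_axioms tensor" "abelian_monoid tensor"
    unfolding abelian_group_axioms_def abelian_monoid_def add_tensor
    by (simp_all add: comm_group.axioms(1))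
qed

lemma coset_hom: "(\<lambda>c. K #>\<^bsub>F\<^esub> c) \<in> hom F (add_monoid tensor)"
  unfolding add_tensor by (rule normal.r_coset_hom_Mod[OF normal_K])

lemma elem_closed: "x \<in> carrier M \<Longrightarrow> y \<in> carrier N \<Longrightarrow> pure x y \<in> carrier tensor"
  using hom_in_carrier[OF coset_hom, of "frag_of (x, y)"] by (simp add: tensor_elem_def)

text \<open>Differences are singled out because \<open>free_Abelian_group_induct\<close>, from which
  \<open>tensor_induct\<close> is derived, has its inductive step for differences.\<close>

lemma coset_diff:
  assumes "c \<in> carrier F" "d \<in> carrier F"
  shows "K #>\<^bsub>F\<^esub> (c - d) = (K #>\<^bsub>F\<^esub> c) \<ominus>\<^bsub>tensor\<^esub> (K #>\<^bsub>F\<^esub> d)"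
proof -
  interpret T: abelian_group tensor by (rule abelian_group_tensor)
  have cd: "c - d \<in> carrier F"
    using assms keys_diff[of c d] by auto
  have "K #>\<^bsub>F\<^esub> c = (K #>\<^bsub>F\<^esub> (c - d)) \<oplus>\<^bsub>tensor\<^esub> (K #>\<^bsub>F\<^esub> d)"
    using hom_mult[OF coset_hom cd assms(2)] by simp
  moreover have "K #>\<^bsub>F\<^esub> (c - d) \<in> carrier tensor" "K #>\<^bsub>F\<^esub> d \<in> carrier tensor"
    using hom_in_carrier[OF coset_hom cd] hom_in_carrier[OF coset_hom assms(2)] by simp_all
  ultimately show ?thesis
    by (simp add: T.minus_eq T.a_assoc T.r_neg)
qed

lemma coset_eq:
  assumes "c \<in> carrier F" "d \<in> carrier F" "c - d \<in> K"
  shows "K #>\<^bsub>F\<^esub> c = K #>\<^bsub>F\<^esub> d"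
proof -
  have "c \<in> K #>\<^bsub>F\<^esub> d"
    unfolding r_coset_def using assms(3) by (auto intro!: bexI[of _ "c - d"])
  then show ?thesis
    using group.repr_independence[OF group_free_Abelian_group _ assms(2) subgroup_K] by simp
qed

lemma relation_in_K: "c \<in> tensor_relations S M \<rho> N \<mu> \<Longrightarrow> c \<in> K"
  unfolding tensor_subgroup_def by (rule generate.incl)

text \<open>Since the coset map is a homomorphism, additivity of pure tensors reduces to a
  congruence modulo \<open>K\<close> between one generator and a sum of two.\<close>

lemma elem_add:
  assumes "K #>\<^bsub>F\<^esub> frag_of p = K #>\<^bsub>F\<^esub> (frag_of q + frag_of r)"
    and "q \<in> carrier M \<times> carrier N" "r \<in> carrier M \<times> carrier N"
  shows "K #>\<^bsub>F\<^esub> frag_of p = (K #>\<^bsub>F\<^esub> frag_of q) \<oplus>\<^bsub>tensor\<^esub> (K #>\<^bsub>F\<^esub> frag_of r)"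
  using hom_mult[OF coset_hom, of "frag_of q" "frag_of r"] assms by simp

lemma keys_frag_add:
  "p \<in> X \<Longrightarrow> q \<in> X \<Longrightarrow> Poly_Mapping.keys (frag_of p + frag_of q) \<subseteq> X"
  using keys_add[of "frag_of p" "frag_of q"] by auto

lemma balanced_elem: "balanced_map S M \<rho> N \<mu> tensor pure"
  unfolding balanced_map_def
proof (intro conjI ballI additive_mapI elem_closed)
  fix x y y' assume *: "x \<in> carrier M" "y \<in> carrier N" "y' \<in> carrier N"
  show "pure x (y \<oplus>\<^bsub>N\<^esub> y') = pure x y \<oplus>\<^bsub>tensor\<^esub> pure x y'"
    unfolding tensor_elem_def
  proof (rule elem_add)
    have "frag_of (x, y \<oplus>\<^bsub>N\<^esub> y') - frag_of (x, y) - frag_of (x, y') \<in> K"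
      by (rule relation_in_K) (use * in \<open>auto simp: tensor_relations_def\<close>)
    then show "K #>\<^bsub>F\<^esub> frag_of (x, y \<oplus>\<^bsub>N\<^esub> y') = K #>\<^bsub>F\<^esub> (frag_of (x, y) + frag_of (x, y'))"
      by (intro coset_eq) (use * in \<open>simp_all add: diff_diff_eq keys_frag_add\<close>)
  qed (use * in auto)
next
  fix x x' y assume *: "x \<in> carrier M" "x' \<in> carrier M" "y \<in> carrier N"
  show "pure (x \<oplus>\<^bsub>M\<^esub> x') y = pure x y \<oplus>\<^bsub>tensor\<^esub> pure x' y"
    unfolding tensor_elem_def
  proof (rule elem_add)
    have "frag_of (x \<oplus>\<^bsub>M\<^esub> x', y) - frag_of (x, y) - frag_of (x', y) \<in> K"
      by (rule relation_in_K) (use * in \<open>auto simp: tensor_relations_def\<close>)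
    then show "K #>\<^bsub>F\<^esub> frag_of (x \<oplus>\<^bsub>M\<^esub> x', y) = K #>\<^bsub>F\<^esub> (frag_of (x, y) + frag_of (x', y))"
      by (intro coset_eq) (use * in \<open>simp_all add: diff_diff_eq keys_frag_add\<close>)
  qed (use * in auto)
next
  fix x s y assume *: "x \<in> carrier M" "s \<in> carrier S" "y \<in> carrier N"
  show "pure (\<rho> x s) y = pure x (\<mu> s y)"
    unfolding tensor_elem_def
  proof (rule coset_eq)
    show "frag_of (\<rho> x s, y) - frag_of (x, \<mu> s y) \<in> K"
      by (rule relation_in_K) (use * in \<open>auto simp: tensor_relations_def\<close>)
  qed (use * in \<open>auto simp: rho_closed mu_closed\<close>)
qed

lemma elem_add_left:
  "x \<in> carrier M \<Longrightarrow> x' \<in> carrier M \<Longrightarrow> y \<in> carrier N \<Longrightarrow>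
    pure (x \<oplus>\<^bsub>M\<^esub> x') y = pure x y \<oplus>\<^bsub>tensor\<^esub> pure x' y"
  and elem_add_right:
  "x \<in> carrier M \<Longrightarrow> y \<in> carrier N \<Longrightarrow> y' \<in> carrier N \<Longrightarrow>
    pure x (y \<oplus>\<^bsub>N\<^esub> y') = pure x y \<oplus>\<^bsub>tensor\<^esub> pure x y'"
  and elem_balanced:
  "x \<in> carrier M \<Longrightarrow> s \<in> carrier S \<Longrightarrow> y \<in> carrier N \<Longrightarrow> pure (\<rho> x s) y = pure x (\<mu> s y)"
  using balanced_elem by (auto simp: balanced_map_def additive_maps_def hom_def)

text \<open>Every element is the coset of a formal sum of pairs, so the pure tensors generate the
  tensor product as a group.\<close>

lemma tensor_induct [consumes 1, case_names zero diff elem]: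
  assumes "q \<in> carrier tensor"
    and zero: "P \<zero>\<^bsub>tensor\<^esub>"
    and diff: "\<And>q q'. q \<in> carrier tensor \<Longrightarrow> q' \<in> carrier tensor \<Longrightarrow> P q \<Longrightarrow> P q' \<Longrightarrow>
      P (q \<ominus>\<^bsub>tensor\<^esub> q')"
    and elem: "\<And>x y. x \<in> carrier M \<Longrightarrow> y \<in> carrier N \<Longrightarrow> P (pure x y)"
  shows "P q"
proof -
  from assms(1) obtain c where c: "c \<in> carrier F" "q = K #>\<^bsub>F\<^esub> c"
    by (auto simp: carrier_tensor carrier_FactGroup)
  have "P (K #>\<^bsub>F\<^esub> c)"
  proof (rule free_Abelian_group_induct[of c "carrier M \<times> carrier N"])
    have "K #>\<^bsub>F\<^esub> 0 = \<zero>\<^bsub>tensor\<^esub>"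
      using hom_one[OF coset_hom group_free_Abelian_group abelian_group.a_group[OF abelian_group_tensor]]
      by simp
    then show "P (K #>\<^bsub>F\<^esub> 0)" using zero by simp
  next
    fix c d assume "Poly_Mapping.keys c \<subseteq> carrier M \<times> carrier N"
      "Poly_Mapping.keys d \<subseteq> carrier M \<times> carrier N" "P (K #>\<^bsub>F\<^esub> c)" "P (K #>\<^bsub>F\<^esub> d)"
    then show "P (K #>\<^bsub>F\<^esub> (c - d))"
      using coset_diff[of c d] diff hom_in_carrier[OF coset_hom] by simp
  next
    fix p assume "p \<in> carrier M \<times> carrier N"
    then show "P (K #>\<^bsub>F\<^esub> frag_of p)" using elem by (auto simp: tensor_elem_def)
  qed (use c in simp)
  with c show ?thesis by simp
qed

text \<open>Two additive maps agree on a subgroup, so agreement on the generating pure tensors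
  suffices.\<close>

lemma tensor_ext:
  assumes G: "abelian_group G"
    and f: "f \<in> additive_maps tensor G" and g: "g \<in> additive_maps tensor G"
    and eq: "\<And>x y. x \<in> carrier M \<Longrightarrow> y \<in> carrier N \<Longrightarrow> f (pure x y) = g (pure x y)"
    and q: "q \<in> carrier tensor"
  shows "f q = g q"
  using q
proof (induction rule: tensor_induct)
  case zero
  then show ?case
    using additive_map_zero[OF abelian_group_tensor G] f g by metis
next
  case (diff q q')
  then show ?case
    using additive_map_minus[OF abelian_group_tensor G] f g by metis
next
  case (elem x y)
  then show ?case by (rule eq)
qed

text \<open>The universal property of the tensor product. The linear extension \<open>h\<close> of
  \<open>\<beta>\<close> kills the relations, hence is constant on each coset of \<open>K\<close>,
  and \<open>the_elem\<close> in \<open>tensor_lift\<close> returns that constant.\<close>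

lemma
  assumes G: "abelian_group G" and \<beta>: "balanced_map S M \<rho> N \<mu> G \<beta>"
  shows tensor_lift_additive: "tensor_lift G \<beta> \<in> additive_maps tensor G"
    and tensor_lift_elem:
      "x \<in> carrier M \<Longrightarrow> y \<in> carrier N \<Longrightarrow> tensor_lift G \<beta> (pure x y) = \<beta> x y"
proof -
  interpret G: abelian_group G by fact
  interpret T: abelian_group tensor by (rule abelian_group_tensor)
  define h where "h = (\<lambda>c :: 'm \<times> 'n \<Rightarrow>\<^sub>0 int. \<Oplus>\<^bsub>G\<^esub>p\<in>Poly_Mapping.keys c.
     add_pow G (Poly_Mapping.lookup c p) (\<beta> (fst p) (snd p)))"
  have closed: "\<beta> x y \<in> carrier G" if "x \<in> carrier M" "y \<in> carrier N" for x y
    using \<beta> that by (auto simp: balanced_map_def additive_maps_def hom_def)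
  have h: "h \<in> hom F (add_monoid G)"
    and h_of: "\<And>x y. x \<in> carrier M \<Longrightarrow> y \<in> carrier N \<Longrightarrow> h (frag_of (x, y)) = \<beta> x y"
    unfolding h_def using frag_sum_hom[OF G, of "carrier M \<times> carrier N" "\<lambda>p. \<beta> (fst p) (snd p)"] closed
    by auto
  interpret h: group_hom F "add_monoid G" h
    by (intro group_hom.intro group_free_Abelian_group G.a_group group_hom_axioms.intro h)
  have h_diff: "h (c - d) = h c \<ominus>\<^bsub>G\<^esub> h d" if "c \<in> carrier F" "d \<in> carrier F" for c d
    using h.hom_mult[of c "- d"] h.hom_inv[of d] that by (simp add: G.minus_eq a_inv_def)
  have keys2: "frag_of p - frag_of q \<in> carrier F"
    if "p \<in> carrier M \<times> carrier N" "q \<in> carrier M \<times> carrier N" for p q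
    using keys_diff[of "frag_of p" "frag_of q"] that by auto
  \<comment> \<open>The three families of relations vanish under \<open>h\<close> by additivity in
    the first variable, additivity in the second, and balancing over \<open>S\<close>.\<close>
  have "tensor_relations S M \<rho> N \<mu> \<subseteq> kernel F (add_monoid G) h"
  proof
    fix c assume c: "c \<in> tensor_relations S M \<rho> N \<mu>"
    then have "h c = \<zero>\<^bsub>G\<^esub>"
      unfolding tensor_relations_def
    proof (elim UnE CollectE exE conjE)
      fix x x' y assume *: "c = frag_of (x \<oplus>\<^bsub>M\<^esub> x', y) - frag_of (x, y) - frag_of (x', y)"
        "x \<in> carrier M" "x' \<in> carrier M" "y \<in> carrier N"
      have "(\<lambda>x. \<beta> x y) \<in> additive_maps M G"
        using \<beta> * by (auto simp: balanced_map_def)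
      then have "\<beta> (x \<oplus>\<^bsub>M\<^esub> x') y = \<beta> x y \<oplus>\<^bsub>G\<^esub> \<beta> x' y"
        using additive_map_add[of _ M G x x'] * by auto
      then show ?thesis
        using * closed by (simp add: h_diff keys2 h_of G.minus_eq G.a_ac G.r_neg G.minus_add
          G.r_neg1 G.r_neg2 del: carrier_free_Abelian_group_iff)
    next
      fix x y y' assume *: "c = frag_of (x, y \<oplus>\<^bsub>N\<^esub> y') - frag_of (x, y) - frag_of (x, y')"
        "x \<in> carrier M" "y \<in> carrier N" "y' \<in> carrier N"
      have "\<beta> x \<in> additive_maps N G"
        using \<beta> * by (auto simp: balanced_map_def)
      then have "\<beta> x (y \<oplus>\<^bsub>N\<^esub> y') = \<beta> x y \<oplus>\<^bsub>G\<^esub> \<beta> x y'"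
        using additive_map_add[of _ N G y y'] * by auto
      then show ?thesis
        using * closed by (simp add: h_diff keys2 h_of G.minus_eq G.a_ac G.r_neg G.minus_add
          G.r_neg1 G.r_neg2 del: carrier_free_Abelian_group_iff)
    next
      fix x s y assume *: "c = frag_of (\<rho> x s, y) - frag_of (x, \<mu> s y)"
        "x \<in> carrier M" "s \<in> carrier S" "y \<in> carrier N"
      then have "\<beta> (\<rho> x s) y = \<beta> x (\<mu> s y)"
        using \<beta> by (auto simp: balanced_map_def)
      then show ?thesis
        using * closed by (simp add: h_diff keys2 h_of rho_closed mu_closed G.minus_eq G.r_neg
          del: carrier_free_Abelian_group_iff)
    qed
    then show "c \<in> kernel F (add_monoid G) h"
      using relations_subset c by (auto simp: kernel_def simp del: carrier_free_Abelian_group_iff)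
  qed
  then have K: "K \<subseteq> kernel F (add_monoid G) h"
    unfolding tensor_subgroup_def
    by (rule group.generate_subgroup_incl[OF group_free_Abelian_group _ h.subgroup_kernel])
  \<comment> \<open>The image of a whole coset under \<open>h\<close> is a singleton, which is what
    makes \<open>the_elem\<close> meaningful.\<close>
  have lift: "tensor_lift G \<beta> (K #>\<^bsub>F\<^esub> c) = h c" if c: "c \<in> carrier F" for c
  proof -
    have "h ` (K #>\<^bsub>F\<^esub> c) = {h c}"
    proof (intro equalityI subsetI)
      fix z assume "z \<in> h ` (K #>\<^bsub>F\<^esub> c)"
      then obtain k where k: "k \<in> K" "z = h (k \<otimes>\<^bsub>F\<^esub> c)"
        by (auto simp: r_coset_def)
      with K have "k \<in> carrier F" "h k = \<zero>\<^bsub>G\<^esub>"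
        by (auto simp: kernel_def)
      with k c hom_in_carrier[OF h c] show "z \<in> {h c}"
        by (simp only: h.hom_mult) simp
    next
      fix z assume "z \<in> {h c}"
      then show "z \<in> h ` (K #>\<^bsub>F\<^esub> c)"
        using group.rcos_self[OF group_free_Abelian_group c subgroup_K] by auto
    qed
    then show ?thesis
      by (simp add: tensor_lift_def h_def)
  qed
  show "tensor_lift G \<beta> (pure x y) = \<beta> x y" if "x \<in> carrier M" "y \<in> carrier N"
    using lift[of "frag_of (x, y)"] that h_of by (simp add: tensor_elem_def)
  show "tensor_lift G \<beta> \<in> additive_maps tensor G"
  proof (rule additive_mapI)
    fix q assume "q \<in> carrier tensor"
    then obtain c where c: "c \<in> carrier F" "q = K #>\<^bsub>F\<^esub> c"
      by (auto simp: carrier_tensor carrier_FactGroup)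
    then show "tensor_lift G \<beta> q \<in> carrier G"
      using lift hom_in_carrier[OF h] by simp
    fix q' assume "q' \<in> carrier tensor"
    then obtain d where d: "d \<in> carrier F" "q' = K #>\<^bsub>F\<^esub> d"
      by (auto simp: carrier_tensor carrier_FactGroup)
    have "q \<oplus>\<^bsub>tensor\<^esub> q' = K #>\<^bsub>F\<^esub> (c \<otimes>\<^bsub>F\<^esub> d)"
      using hom_mult[OF coset_hom c(1) d(1)] c d by simp
    moreover have "c \<otimes>\<^bsub>F\<^esub> d \<in> carrier F"
      by (rule monoid.m_closed[OF group.axioms(1)[OF group_free_Abelian_group] c(1) d(1)])
    ultimately show "tensor_lift G \<beta> (q \<oplus>\<^bsub>tensor\<^esub> q') = tensor_lift G \<beta> q \<oplus>\<^bsub>G\<^esub> tensor_lift G \<beta> q'"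
      using hom_mult[OF h c(1) d(1)] c d by (simp only: lift) simp
  qed
qed

text \<open>The third assumption is the balancing condition for the map sending \<open>x\<close>,
  \<open>y\<close> to \<open>pure (f x) (g y)\<close>; \<open>tensor_map\<close> is its
  lift.\<close>

lemma
  assumes "f \<in> additive_maps M M" "g \<in> additive_maps N N"
    and "\<And>x s y. x \<in> carrier M \<Longrightarrow> s \<in> carrier S \<Longrightarrow> y \<in> carrier N \<Longrightarrow>
      pure (f (\<rho> x s)) (g y) = pure (f x) (g (\<mu> s y))"
  shows tensor_map_additive: "tensor_map S M \<rho> N \<mu> f g \<in> additive_maps tensor tensor"
    and tensor_map_elem: "x \<in> carrier M \<Longrightarrow> y \<in> carrier N \<Longrightarrow>
      tensor_map S M \<rho> N \<mu> f g (pure x y) = pure (f x) (g y)"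
proof -
  have "balanced_map S M \<rho> N \<mu> tensor (\<lambda>x y. pure (f x) (g y))"
    unfolding balanced_map_def
    by (intro conjI ballI additive_mapI)
      (simp_all add: assms(3) elem_closed elem_add_left elem_add_right
        additive_map_closed[OF assms(1)] additive_map_closed[OF assms(2)]
        additive_map_add[OF assms(1)] additive_map_add[OF assms(2)])
  note * = tensor_lift_additive[OF abelian_group_tensor this]
    tensor_lift_elem[OF abelian_group_tensor this]
  show "tensor_map S M \<rho> N \<mu> f g \<in> additive_maps tensor tensor"
    unfolding tensor_map_def by (rule *(1))
  show "tensor_map S M \<rho> N \<mu> f g (pure x y) = pure (f x) (g y)"
    if "x \<in> carrier M" "y \<in> carrier N"
    unfolding tensor_map_def by (rule *(2)[OF that])
qed

end

section \<open>The tensor square of a ring extension\<close>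

lemma make_bimodule_simps [simp]:
  "carrier (make_bimodule M l r) = carrier M"
  "ring.add (make_bimodule M l r) = ring.add M"
  "ring.zero (make_bimodule M l r) = ring.zero M"
  "lact (make_bimodule M l r) = l"
  "ract (make_bimodule M l r) = r"
  by (simp_all add: make_bimodule_def ring.defs bimodule.defs)

text \<open>A record built by \<open>make_bimodule\<close> differs from the underlying tensor
  product but shares its additive structure; this lemma and the next carry results from one to the
  other.\<close>

lemma additive_maps_cong:
  assumes "carrier M = carrier M'" "ring.add M = ring.add M'"
    and "carrier N = carrier N'" "ring.add N = ring.add N'"
  shows "additive_maps M N = additive_maps M' N'"
  using assms by (simp add: additive_maps_def hom_def)

lemma abelian_group_cong:
  assumes "abelian_group M"
    and eq: "carrier M' = carrier M" "ring.add M' = ring.add M" "ring.zero M' = ring.zero M"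
  shows "abelian_group M'"
proof -
  interpret abelian_group M by fact
  show ?thesis
    by (rule abelian_groupI) (auto simp: eq a_ac intro: l_neg)
qed

section \<open>The tensor square with its outer actions of \<open>A\<close>\<close>

context ring_extension
begin

lemma phi_closed [simp]: "b \<in> carrier B \<Longrightarrow> \<phi> b \<in> carrier A"
  using hom by (rule ring_hom_closed)

sublocale square: tensor_data B A "\<lambda>a b. a \<otimes>\<^bsub>A\<^esub> \<phi> b" A "\<lambda>b a. \<phi> b \<otimes>\<^bsub>A\<^esub> a"
  by unfold_locales simp_all

text \<open>The \<open>A\<close>-\<open>A\<close>-version serves as reference: for every choice of
  \<open>\<sigma>\<close> and \<open>\<tau>\<close> the additive group is the same, and the actions
  are those of \<open>P\<close> pulled back along \<open>\<sigma>\<close> and \<open>\<tau>\<close>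
  (see \<open>square_actions\<close>).\<close>

definition "P = tensor_square A B \<phi> id id"
abbreviation "R \<equiv> centralizer A B \<phi>"
abbreviation "T \<equiv> T_ring A B \<phi>"
abbreviation pure_square (infixl \<open>\<odot>\<close> 70) where "x \<odot> y \<equiv> square.pure x y"
abbreviation lact_square (infixr \<open>\<rhd>\<close> 72) where "a \<rhd> p \<equiv> lact P a p"
abbreviation ract_square (infixl \<open>\<lhd>\<close> 71) where "p \<lhd> a \<equiv> ract P p a"

lemma square_simps:
  "carrier (tensor_square A B \<phi> \<sigma> \<tau>) = carrier square.tensor"
  "ring.add (tensor_square A B \<phi> \<sigma> \<tau>) = ring.add square.tensor"
  "ring.zero (tensor_square A B \<phi> \<sigma> \<tau>) = ring.zero square.tensor"
  by (simp_all add: tensor_square_def Let_def)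

lemma P_simps:
  "carrier P = carrier square.tensor"
  "ring.add P = ring.add square.tensor"
  "ring.zero P = ring.zero square.tensor"
  by (simp_all only: P_def square_simps)

lemma square_actions:
  "lact (tensor_square A B \<phi> \<sigma> \<tau>) l p = \<sigma> l \<rhd> p"
  "ract (tensor_square A B \<phi> \<sigma> \<tau>) p r = p \<lhd> \<tau> r"
  by (simp_all add: P_def tensor_square_def Let_def)

lemma abelian_group_square: "abelian_group P"
  by (rule abelian_group_cong[OF square.abelian_group_tensor]) (rule P_simps)+

sublocale P: abelian_group P
  by (rule abelian_group_square)

lemma additive_maps_square:
  "additive_maps P G = additive_maps square.tensor G"
  "additive_maps G P = additive_maps G square.tensor"
  by (rule additive_maps_cong; simp add: P_simps)+

lemma pure_closed [simp]: "x \<in> carrier A \<Longrightarrow> y \<in> carrier A \<Longrightarrow> x \<odot> y \<in> carrier P"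
  using square.elem_closed by (simp add: P_simps)

text \<open>By associativity, left multiplication by \<open>a\<close> respects the right action of
  \<open>B\<close> on the first factor, and right multiplication respects the left action of
  \<open>B\<close> on the second. Both therefore descend to the balanced tensor product.\<close>

lemma lact_additive: "a \<in> carrier A \<Longrightarrow> lact P a \<in> additive_maps P P"
  and lact_pure [simp]: "a \<in> carrier A \<Longrightarrow> x \<in> carrier A \<Longrightarrow> y \<in> carrier A \<Longrightarrow>
    a \<rhd> (x \<odot> y) = (a \<otimes>\<^bsub>A\<^esub> x) \<odot> y"
  and ract_additive: "a \<in> carrier A \<Longrightarrow> (\<lambda>p. p \<lhd> a) \<in> additive_maps P P"
  and ract_pure [simp]: "a \<in> carrier A \<Longrightarrow> x \<in> carrier A \<Longrightarrow> y \<in> carrier A \<Longrightarrow>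
    (x \<odot> y) \<lhd> a = x \<odot> (y \<otimes>\<^bsub>A\<^esub> a)"
proof -
  assume a: "a \<in> carrier A"
  have l: "(\<lambda>x. a \<otimes>\<^bsub>A\<^esub> x) \<in> additive_maps A A" and r: "(\<lambda>x. x \<otimes>\<^bsub>A\<^esub> a) \<in> additive_maps A A"
    and id: "id \<in> additive_maps A A"
    using a by (auto intro!: additive_mapI simp: A.r_distr A.l_distr)
  have eq: "lact P a = tensor_map B A (\<lambda>a b. a \<otimes>\<^bsub>A\<^esub> \<phi> b) A (\<lambda>b a. \<phi> b \<otimes>\<^bsub>A\<^esub> a) (\<lambda>x. a \<otimes>\<^bsub>A\<^esub> x) id"
    "(\<lambda>p. p \<lhd> a) = tensor_map B A (\<lambda>a b. a \<otimes>\<^bsub>A\<^esub> \<phi> b) A (\<lambda>b a. \<phi> b \<otimes>\<^bsub>A\<^esub> a) id (\<lambda>x. x \<otimes>\<^bsub>A\<^esub> a)"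
    by (simp_all add: P_def tensor_square_def Let_def)
  have 1: "(a \<otimes>\<^bsub>A\<^esub> (x \<otimes>\<^bsub>A\<^esub> \<phi> s)) \<odot> id y = (a \<otimes>\<^bsub>A\<^esub> x) \<odot> id (\<phi> s \<otimes>\<^bsub>A\<^esub> y)"
    if "x \<in> carrier A" "s \<in> carrier B" "y \<in> carrier A" for x s y
    using square.elem_balanced[of "a \<otimes>\<^bsub>A\<^esub> x" s y] that a by (simp add: A.m_assoc)
  have 2: "id (x \<otimes>\<^bsub>A\<^esub> \<phi> s) \<odot> (y \<otimes>\<^bsub>A\<^esub> a) = id x \<odot> (\<phi> s \<otimes>\<^bsub>A\<^esub> y \<otimes>\<^bsub>A\<^esub> a)"
    if "x \<in> carrier A" "s \<in> carrier B" "y \<in> carrier A" for x s y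
    using square.elem_balanced[of x s "y \<otimes>\<^bsub>A\<^esub> a"] that a by (simp add: A.m_assoc)
  note m1 = square.tensor_map_additive[OF l id 1] square.tensor_map_elem[OF l id 1]
  note m2 = square.tensor_map_additive[OF id r 2] square.tensor_map_elem[OF id r 2]
  show "lact P a \<in> additive_maps P P"
    unfolding additive_maps_square eq by (rule m1(1))
  show "(\<lambda>p. p \<lhd> a) \<in> additive_maps P P"
    unfolding additive_maps_square eq by (rule m2(1))
  show "a \<rhd> (x \<odot> y) = (a \<otimes>\<^bsub>A\<^esub> x) \<odot> y" "(x \<odot> y) \<lhd> a = x \<odot> (y \<otimes>\<^bsub>A\<^esub> a)"
    if "x \<in> carrier A" "y \<in> carrier A"
    using m1(2)[OF _ _ _ that] m2(2)[OF _ _ _ that] eq by (metis id_apply)+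
qed

lemma lact_closed [simp]: "a \<in> carrier A \<Longrightarrow> p \<in> carrier P \<Longrightarrow> a \<rhd> p \<in> carrier P"
  by (rule additive_map_closed[OF lact_additive])

lemma ract_closed [simp]: "a \<in> carrier A \<Longrightarrow> p \<in> carrier P \<Longrightarrow> p \<lhd> a \<in> carrier P"
  by (rule additive_map_closed[OF ract_additive])

lemma lact_add: "a \<in> carrier A \<Longrightarrow> p \<in> carrier P \<Longrightarrow> q \<in> carrier P \<Longrightarrow>
    a \<rhd> (p \<oplus>\<^bsub>P\<^esub> q) = a \<rhd> p \<oplus>\<^bsub>P\<^esub> a \<rhd> q"
  by (rule additive_map_add[OF lact_additive])

lemma pure_add_left: "x \<in> carrier A \<Longrightarrow> x' \<in> carrier A \<Longrightarrow> y \<in> carrier A \<Longrightarrow>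
    (x \<oplus>\<^bsub>A\<^esub> x') \<odot> y = x \<odot> y \<oplus>\<^bsub>P\<^esub> x' \<odot> y"
  using square.elem_add_left by (simp add: P_simps)

lemma pure_add_right: "x \<in> carrier A \<Longrightarrow> y \<in> carrier A \<Longrightarrow> y' \<in> carrier A \<Longrightarrow>
    x \<odot> (y \<oplus>\<^bsub>A\<^esub> y') = x \<odot> y \<oplus>\<^bsub>P\<^esub> x \<odot> y'"
  using square.elem_add_right by (simp add: P_simps)

text \<open>The form of \<open>tensor_ext\<close> for the record \<open>P\<close>. The laws for the
  actions below are read off from pure tensors through it.\<close>

lemma square_ext:
  assumes "abelian_group G" "f \<in> additive_maps P G" "g \<in> additive_maps P G"
    and "\<And>x y. x \<in> carrier A \<Longrightarrow> y \<in> carrier A \<Longrightarrow> f (x \<odot> y) = g (x \<odot> y)"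
    and "p \<in> carrier P"
  shows "f p = g p"
  by (rule square.tensor_ext[OF assms(1)])
    (use assms(2-5) in \<open>simp_all only: additive_maps_square P_simps\<close>)

lemma lact_lact:
  assumes "a \<in> carrier A" "a' \<in> carrier A" "p \<in> carrier P"
  shows "a \<rhd> a' \<rhd> p = (a \<otimes>\<^bsub>A\<^esub> a') \<rhd> p"
  by (rule square_ext[OF abelian_group_square _ _ _ assms(3)])
    (use assms in \<open>simp_all add: A.m_assoc lact_additive
      additive_map_comp[OF lact_additive lact_additive]\<close>)

lemma ract_ract:
  assumes "a \<in> carrier A" "a' \<in> carrier A" "p \<in> carrier P"
  shows "p \<lhd> a \<lhd> a' = p \<lhd> (a \<otimes>\<^bsub>A\<^esub> a')"
  by (rule square_ext[OF abelian_group_square _ _ _ assms(3)])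
    (use assms in \<open>simp_all add: A.m_assoc ract_additive
      additive_map_comp[OF ract_additive ract_additive]\<close>)

lemma lact_ract:
  assumes "a \<in> carrier A" "a' \<in> carrier A" "p \<in> carrier P"
  shows "a \<rhd> (p \<lhd> a') = (a \<rhd> p) \<lhd> a'"
  by (rule square_ext[OF abelian_group_square _ _ _ assms(3)])
    (use assms in \<open>simp_all add: additive_map_comp[OF lact_additive ract_additive]
      additive_map_comp[OF ract_additive lact_additive]\<close>)

lemma lact_add_scalar:
  assumes "a \<in> carrier A" "a' \<in> carrier A" "p \<in> carrier P"
  shows "(a \<oplus>\<^bsub>A\<^esub> a') \<rhd> p = a \<rhd> p \<oplus>\<^bsub>P\<^esub> a' \<rhd> p"
  by (rule square_ext[OF abelian_group_square _ _ _ assms(3)])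
    (use assms in \<open>simp_all add: A.l_distr pure_add_left lact_additive
      additive_map_pointwise_add[OF abelian_group_square]\<close>)

lemma ract_add_scalar:
  assumes "a \<in> carrier A" "a' \<in> carrier A" "p \<in> carrier P"
  shows "p \<lhd> (a \<oplus>\<^bsub>A\<^esub> a') = p \<lhd> a \<oplus>\<^bsub>P\<^esub> p \<lhd> a'"
  by (rule square_ext[OF abelian_group_square _ _ _ assms(3)])
    (use assms in \<open>simp_all add: A.r_distr pure_add_right ract_additive
      additive_map_pointwise_add[OF abelian_group_square]\<close>)

lemma lact_one:
  assumes "p \<in> carrier P" shows "\<one>\<^bsub>A\<^esub> \<rhd> p = p"
  by (rule square_ext[OF abelian_group_square _ _ _ assms])
    (simp_all add: lact_additive additive_mapI)

section \<open>The centralizer \<open>R\<close>, the invariants \<open>T\<close>, and the actions of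
  \<open>T\<close>\<close>

lemma carrier_R:
  "carrier R = {r \<in> carrier A. \<forall>b\<in>carrier B. \<phi> b \<otimes>\<^bsub>A\<^esub> r = r \<otimes>\<^bsub>A\<^esub> \<phi> b}"
  by (simp add: centralizer_def invariants_def regular_bimodule_def)

lemma R_simps [simp]:
  "ring.add R = ring.add A" "ring.zero R = ring.zero A" "monoid.mult R = monoid.mult A" "one R = one A"
  by (simp_all add: centralizer_def)

lemma R_in_A: "r \<in> carrier R \<Longrightarrow> r \<in> carrier A"
  by (simp add: carrier_R)

lemma R_commutes: "r \<in> carrier R \<Longrightarrow> b \<in> carrier B \<Longrightarrow> \<phi> b \<otimes>\<^bsub>A\<^esub> r = r \<otimes>\<^bsub>A\<^esub> \<phi> b"
  by (simp add: carrier_R)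

lemma one_R: "\<one>\<^bsub>A\<^esub> \<in> carrier R"
  by (simp add: carrier_R)

lemma abelian_group_R: "abelian_group R"
proof (rule abelian_groupI)
  fix x assume "x \<in> carrier R"
  then show "\<exists>y\<in>carrier R. y \<oplus>\<^bsub>R\<^esub> x = \<zero>\<^bsub>R\<^esub>"
    by (intro bexI[of _ "\<ominus>\<^bsub>A\<^esub> x"]) (auto simp: carrier_R A.l_minus A.r_minus A.l_neg)
qed (auto simp: carrier_R A.l_distr A.r_distr A.a_ac)

lemma carrier_T:
  "carrier T = {t \<in> carrier P. \<forall>b\<in>carrier B. \<phi> b \<rhd> t = t \<lhd> \<phi> b}"
  by (simp add: T_ring_def invariants_def square_simps P_simps square_actions)

lemma T_in_square: "t \<in> carrier T \<Longrightarrow> t \<in> carrier P"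
  by (simp add: carrier_T)

lemma T_commutes: "t \<in> carrier T \<Longrightarrow> b \<in> carrier B \<Longrightarrow> \<phi> b \<rhd> t = t \<lhd> \<phi> b"
  by (simp add: carrier_T)

text \<open>For fixed \<open>t\<close> the assignment \<open>x \<rhd> (t \<lhd> y)\<close> is
  balanced because \<open>\<phi> b\<close> can be slid through \<open>t\<close> from the left to the
  right; this is where the invariance of \<open>t\<close> enters.\<close>

lemma
  assumes t: "t \<in> carrier T"
  shows T_lact_additive: "T_lact A B \<phi> t \<in> additive_maps P P"
    and T_lact_pure: "x \<in> carrier A \<Longrightarrow> y \<in> carrier A \<Longrightarrow> T_lact A B \<phi> t (x \<odot> y) = x \<rhd> (t \<lhd> y)"
proof -
  have t': "t \<in> carrier P" using t by (rule T_in_square)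
  have "balanced_map B A (\<lambda>a b. a \<otimes>\<^bsub>A\<^esub> \<phi> b) A (\<lambda>b a. \<phi> b \<otimes>\<^bsub>A\<^esub> a) P (\<lambda>x y. x \<rhd> (t \<lhd> y))"
    unfolding balanced_map_def
  proof (intro conjI ballI additive_mapI)
    fix x b y assume "x \<in> carrier A" "b \<in> carrier B" "y \<in> carrier A"
    then show "(x \<otimes>\<^bsub>A\<^esub> \<phi> b) \<rhd> (t \<lhd> y) = x \<rhd> (t \<lhd> (\<phi> b \<otimes>\<^bsub>A\<^esub> y))"
      using t' by (simp add: lact_lact[symmetric] ract_ract[symmetric] lact_ract T_commutes[OF t])
  qed (use t' in \<open>simp_all add: lact_add_scalar ract_add_scalar lact_add\<close>)
  note * = square.tensor_lift_additive[OF abelian_group_square this]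
    square.tensor_lift_elem[OF abelian_group_square this]
  show "T_lact A B \<phi> t \<in> additive_maps P P"
    using *(1) by (simp add: T_lact_def Let_def P_def[symmetric] additive_maps_square(1))
  show "x \<in> carrier A \<Longrightarrow> y \<in> carrier A \<Longrightarrow> T_lact A B \<phi> t (x \<odot> y) = x \<rhd> (t \<lhd> y)"
    using *(2) by (simp add: T_lact_def Let_def P_def[symmetric])
qed

lemma T_lact_closed: "t \<in> carrier T \<Longrightarrow> p \<in> carrier P \<Longrightarrow> T_lact A B \<phi> t p \<in> carrier P"
  by (rule additive_map_closed[OF T_lact_additive])

text \<open>\<open>T\<close> acts between the two tensor factors and \<open>A\<close> acts on the
  outside. This commutation lets the outer actions pass to the tensor product over
  \<open>T\<close>.\<close>

lemma T_lact_bilinear: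
  assumes "t \<in> carrier T" "a \<in> carrier A" "p \<in> carrier P"
  shows "T_lact A B \<phi> t (a \<rhd> p) = a \<rhd> T_lact A B \<phi> t p"
    and "T_lact A B \<phi> t (p \<lhd> a) = T_lact A B \<phi> t p \<lhd> a"
proof -
  show "T_lact A B \<phi> t (a \<rhd> p) = a \<rhd> T_lact A B \<phi> t p"
    by (rule square_ext[OF abelian_group_square
          additive_map_comp[OF lact_additive T_lact_additive]
          additive_map_comp[OF T_lact_additive lact_additive] _ assms(3)])
      (use assms in \<open>simp_all add: T_lact_pure T_in_square lact_lact\<close>)
  show "T_lact A B \<phi> t (p \<lhd> a) = T_lact A B \<phi> t p \<lhd> a"
    by (rule square_ext[OF abelian_group_square
          additive_map_comp[OF ract_additive T_lact_additive]
          additive_map_comp[OF T_lact_additive ract_additive] _ assms(3)])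
      (use assms in \<open>simp_all add: T_lact_pure T_in_square ract_ract[symmetric] lact_ract\<close>)
qed

text \<open>Here \<open>r\<close> commuting with \<open>B\<close> gives the balancing. The second
  argument ranges over all of \<open>P\<close>: on \<open>T\<close> this is the module action on
  \<open>R\<close>, while on \<open>P\<close> it is the pairing with values in \<open>A\<close> that
  induces the first isomorphism.\<close>

lemma
  assumes r: "r \<in> carrier R"
  shows T_ract_additive: "T_ract A r \<in> additive_maps P A"
    and T_ract_pure: "x \<in> carrier A \<Longrightarrow> y \<in> carrier A \<Longrightarrow> T_ract A r (x \<odot> y) = x \<otimes>\<^bsub>A\<^esub> r \<otimes>\<^bsub>A\<^esub> y"
proof -
  have r': "r \<in> carrier A" using r by (rule R_in_A)
  have "balanced_map B A (\<lambda>a b. a \<otimes>\<^bsub>A\<^esub> \<phi> b) A (\<lambda>b a. \<phi> b \<otimes>\<^bsub>A\<^esub> a) A (\<lambda>x y. x \<otimes>\<^bsub>A\<^esub> r \<otimes>\<^bsub>A\<^esub> y)"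
    unfolding balanced_map_def
  proof (intro conjI ballI additive_mapI)
    fix x b y assume *: "x \<in> carrier A" "b \<in> carrier B" "y \<in> carrier A"
    then have "x \<otimes>\<^bsub>A\<^esub> \<phi> b \<otimes>\<^bsub>A\<^esub> r \<otimes>\<^bsub>A\<^esub> y = x \<otimes>\<^bsub>A\<^esub> (\<phi> b \<otimes>\<^bsub>A\<^esub> r) \<otimes>\<^bsub>A\<^esub> y"
      using r' by (simp add: A.m_assoc)
    also have "\<dots> = x \<otimes>\<^bsub>A\<^esub> r \<otimes>\<^bsub>A\<^esub> (\<phi> b \<otimes>\<^bsub>A\<^esub> y)"
      using * r' unfolding R_commutes[OF r *(2)] by (simp add: A.m_assoc)
    finally show "x \<otimes>\<^bsub>A\<^esub> \<phi> b \<otimes>\<^bsub>A\<^esub> r \<otimes>\<^bsub>A\<^esub> y = x \<otimes>\<^bsub>A\<^esub> r \<otimes>\<^bsub>A\<^esub> (\<phi> b \<otimes>\<^bsub>A\<^esub> y)" .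
  qed (use r' in \<open>simp_all add: A.l_distr A.r_distr\<close>)
  note * = square.tensor_lift_additive[OF A.abelian_group_axioms this]
    square.tensor_lift_elem[OF A.abelian_group_axioms this]
  show "T_ract A r \<in> additive_maps P A"
    using *(1) by (simp add: T_ract_def[abs_def] additive_maps_square(1))
  show "x \<in> carrier A \<Longrightarrow> y \<in> carrier A \<Longrightarrow> T_ract A r (x \<odot> y) = x \<otimes>\<^bsub>A\<^esub> r \<otimes>\<^bsub>A\<^esub> y"
    using *(2) by (simp add: T_ract_def)
qed

lemma T_ract_closed: "r \<in> carrier R \<Longrightarrow> p \<in> carrier P \<Longrightarrow> T_ract A r p \<in> carrier A"
  by (rule additive_map_closed[OF T_ract_additive])

lemma mult_additive:
  assumes "a \<in> carrier A"
  shows "(\<lambda>x. a \<otimes>\<^bsub>A\<^esub> x) \<in> additive_maps A A" "(\<lambda>x. x \<otimes>\<^bsub>A\<^esub> a) \<in> additive_maps A A"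
  using assms by (auto intro!: additive_mapI simp: A.l_distr A.r_distr)

lemma T_ract_bilinear:
  assumes "r \<in> carrier R" "a \<in> carrier A" "p \<in> carrier P"
  shows "T_ract A r (a \<rhd> p) = a \<otimes>\<^bsub>A\<^esub> T_ract A r p"
    and "T_ract A r (p \<lhd> a) = T_ract A r p \<otimes>\<^bsub>A\<^esub> a"
proof -
  show "T_ract A r (a \<rhd> p) = a \<otimes>\<^bsub>A\<^esub> T_ract A r p"
    by (rule square_ext[OF A.abelian_group_axioms
          additive_map_comp[OF lact_additive T_ract_additive]
          additive_map_comp[OF T_ract_additive mult_additive(1)] _ assms(3)])
      (use assms in \<open>simp_all add: T_ract_pure R_in_A A.m_assoc\<close>)
  show "T_ract A r (p \<lhd> a) = T_ract A r p \<otimes>\<^bsub>A\<^esub> a"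
    by (rule square_ext[OF A.abelian_group_axioms
          additive_map_comp[OF ract_additive T_ract_additive]
          additive_map_comp[OF T_ract_additive mult_additive(2)] _ assms(3)])
      (use assms in \<open>simp_all add: T_ract_pure R_in_A A.m_assoc\<close>)
qed

text \<open>By bilinearity, multiplying the value by \<open>\<phi> b\<close> on either side amounts
  to acting on \<open>t\<close> from that side, and the two results agree since \<open>t\<close> is
  invariant.\<close>

lemma T_ract_in_R:
  assumes "r \<in> carrier R" "t \<in> carrier T"
  shows "T_ract A r t \<in> carrier R"
proof -
  note t = T_in_square[OF assms(2)]
  have "\<phi> b \<otimes>\<^bsub>A\<^esub> T_ract A r t = T_ract A r t \<otimes>\<^bsub>A\<^esub> \<phi> b" if "b \<in> carrier B" for b
    using that assms t T_ract_bilinear[OF assms(1) _ t, of "\<phi> b"] by (simp add: T_commutes)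
  then show ?thesis
    using assms t by (simp add: carrier_R T_ract_closed)
qed

text \<open>At \<open>x \<odot> y\<close> both sides equal \<open>x\<close> times
  \<open>T_ract A r t\<close> times \<open>y\<close>. For \<open>p\<close> in \<open>T\<close> this
  is associativity of the action on \<open>R\<close>; for general \<open>p\<close> it is the
  balancing of the pairing over \<open>T\<close>.\<close>

lemma T_ract_T_ract:
  assumes "r \<in> carrier R" "t \<in> carrier T" "p \<in> carrier P"
  shows "T_ract A (T_ract A r t) p = T_ract A r (T_lact A B \<phi> t p)"
proof (rule square_ext[OF A.abelian_group_axioms _ _ _ assms(3)])
  fix x y assume *: "x \<in> carrier A" "y \<in> carrier A"
  then show "T_ract A (T_ract A r t) (x \<odot> y) = T_ract A r (T_lact A B \<phi> t (x \<odot> y))"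
    using assms by (simp add: T_ract_pure T_ract_in_R T_lact_pure T_ract_bilinear T_in_square
      A.m_assoc T_ract_closed)
qed (use assms in \<open>simp_all add: T_ract_additive T_ract_in_R
  additive_map_comp[OF T_lact_additive T_ract_additive]\<close>)

lemma T_ract_add:
  assumes "r \<in> carrier R" "s \<in> carrier R" "p \<in> carrier P"
  shows "T_ract A (r \<oplus>\<^bsub>A\<^esub> s) p = T_ract A r p \<oplus>\<^bsub>A\<^esub> T_ract A s p"
proof -
  have rs: "r \<oplus>\<^bsub>A\<^esub> s \<in> carrier R"
    using abelian_groupE(1)[OF abelian_group_R assms(1,2)] by simp
  show ?thesis
    by (rule square_ext[OF A.abelian_group_axioms _ _ _ assms(3)])
      (use assms rs in \<open>simp_all add: T_ract_pure A.l_distr A.r_distr R_in_A T_ract_additive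
        additive_map_pointwise_add[OF A.abelian_group_axioms]\<close>)
qed

section \<open>The tensor product of \<open>R\<close> and \<open>P\<close> over
  \<open>T\<close>\<close>

sublocale CT: tensor_data T R "T_ract A" P "T_lact A B \<phi>"
  by (intro tensor_data.intro abelian_group_R abelian_group_square tensor_data_axioms.intro
      T_ract_in_R T_lact_closed)

text \<open>This provides the map out of the tensor product over \<open>T\<close>; compatibility
  with the action of \<open>T\<close> is \<open>T_ract_T_ract\<close>.\<close>

lemma balanced_T_ract: "balanced_map T R (T_ract A) P (T_lact A B \<phi>) A (T_ract A)"
  unfolding balanced_map_def
  by (intro conjI ballI T_ract_additive)
    (simp_all add: T_ract_T_ract additive_mapI T_ract_add T_ract_closed)

end

section \<open>Direct summands of free modules\<close>

lemma sub_bimodule_closed: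
  assumes "sub_bimodule L R P N"
  shows "P \<subseteq> carrier N" "\<zero>\<^bsub>N\<^esub> \<in> P"
    and "x \<in> P \<Longrightarrow> y \<in> P \<Longrightarrow> x \<oplus>\<^bsub>N\<^esub> y \<in> P"
    and "x \<in> P \<Longrightarrow> \<ominus>\<^bsub>N\<^esub> x \<in> P"
    and "a \<in> carrier L \<Longrightarrow> x \<in> P \<Longrightarrow> lact N a x \<in> P"
    and "x \<in> P \<Longrightarrow> b \<in> carrier R \<Longrightarrow> ract N x b \<in> P"
  using assms subgroup.subset[of P "add_monoid N"] subgroup.one_closed[of P "add_monoid N"]
    subgroup.m_closed[of P "add_monoid N" x y] subgroup.m_inv_closed[of P "add_monoid N" x]
  by (auto simp: sub_bimodule_def a_inv_def)

text \<open>The map \<open>\<pi>\<close> is the projection of \<open>N\<close> onto \<open>P\<close>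
  along \<open>Q\<close>, followed by the inverse of the isomorphism \<open>\<iota>\<close> from
  \<open>M\<close> to \<open>P\<close>. It is linear because both summands are stable under the
  actions.\<close>

lemma direct_summand_retraction:
  fixes M :: "('l, 'm, 'r, 'u) bimodule_scheme" and N :: "('l, 'n, 'r, 'v) bimodule_scheme"
  assumes "iso_to_direct_summand L R M N" and M: "abelian_group M" and N: "abelian_group N"
    and M_lact: "\<And>a x. a \<in> carrier L \<Longrightarrow> x \<in> carrier M \<Longrightarrow> lact M a x \<in> carrier M"
    and M_ract: "\<And>b x. b \<in> carrier R \<Longrightarrow> x \<in> carrier M \<Longrightarrow> ract M x b \<in> carrier M"
    and N_lact: "\<And>a. a \<in> carrier L \<Longrightarrow> lact N a \<in> additive_maps N N"
    and N_ract: "\<And>b. b \<in> carrier R \<Longrightarrow> (\<lambda>x. ract N x b) \<in> additive_maps N N"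
  obtains \<iota> \<pi> where "\<iota> \<in> bimodule_hom L R M N" "\<pi> \<in> bimodule_hom L R N M"
    "\<And>x. x \<in> carrier M \<Longrightarrow> \<pi> (\<iota> x) = x"
proof -
  interpret M: abelian_group M by fact
  interpret N: abelian_group N by fact
  obtain P Q \<iota> where P: "sub_bimodule L R P N" and Q: "sub_bimodule L R Q N"
    and PQ: "P \<inter> Q = {\<zero>\<^bsub>N\<^esub>}" "P <+>\<^bsub>N\<^esub> Q = carrier N"
    and hom: "\<iota> \<in> bimodule_hom L R M (N\<lparr>carrier := P\<rparr>)" and bij: "bij_betw \<iota> (carrier M) P"
    using assms(1) by (auto simp: iso_to_direct_summand_def bimodule_isomorphic_def)
  note P_closed = sub_bimodule_closed[OF P] and Q_closed = sub_bimodule_closed[OF Q]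
  have \<iota>_in: "\<iota> x \<in> P" "\<iota> x \<in> carrier N" if "x \<in> carrier M" for x
    using bij that P_closed(1) by (auto simp: bij_betw_def)
  have \<iota>_hom: "\<iota> (x \<oplus>\<^bsub>M\<^esub> y) = \<iota> x \<oplus>\<^bsub>N\<^esub> \<iota> y" "a \<in> carrier L \<Longrightarrow> \<iota> (lact M a x) = lact N a (\<iota> x)"
    "b \<in> carrier R \<Longrightarrow> \<iota> (ract M x b) = ract N (\<iota> x) b"
    if "x \<in> carrier M" "y \<in> carrier M" for x y a b
    using hom that by (auto simp: bimodule_hom_def)
  have Q_in: "q \<in> carrier N" if "q \<in> Q" for q
    using that Q_closed(1) by auto
  define \<pi> where "\<pi> v = (THE x. x \<in> carrier M \<and> (\<exists>q\<in>Q. v = \<iota> x \<oplus>\<^bsub>N\<^esub> q))" for v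
  have \<pi>: "\<pi> (\<iota> x \<oplus>\<^bsub>N\<^esub> q) = x" if x: "x \<in> carrier M" and q: "q \<in> Q" for x q
    unfolding \<pi>_def
  proof (rule the_equality)
    fix x' assume "x' \<in> carrier M \<and> (\<exists>q'\<in>Q. \<iota> x \<oplus>\<^bsub>N\<^esub> q = \<iota> x' \<oplus>\<^bsub>N\<^esub> q')"
    then obtain q' where x': "x' \<in> carrier M" "q' \<in> Q" "\<iota> x \<oplus>\<^bsub>N\<^esub> q = \<iota> x' \<oplus>\<^bsub>N\<^esub> q'"
      by auto
    \<comment> \<open>Two decompositions of one vector are compared: the difference of the
      \<open>P\<close>-parts equals a difference of \<open>Q\<close>-parts, so it lies in the
      intersection and vanishes.\<close>
    have "\<iota> x \<ominus>\<^bsub>N\<^esub> \<iota> x' = \<iota> x \<oplus>\<^bsub>N\<^esub> q \<ominus>\<^bsub>N\<^esub> q \<ominus>\<^bsub>N\<^esub> \<iota> x'"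
      using x q x'(1) \<iota>_in Q_in by (simp add: N.minus_eq N.a_assoc N.r_neg)
    also have "\<dots> = \<iota> x' \<oplus>\<^bsub>N\<^esub> q' \<ominus>\<^bsub>N\<^esub> q \<ominus>\<^bsub>N\<^esub> \<iota> x'"
      by (simp only: x'(3))
    also have "\<dots> = \<iota> x' \<oplus>\<^bsub>N\<^esub> (\<ominus>\<^bsub>N\<^esub> \<iota> x' \<oplus>\<^bsub>N\<^esub> (q' \<ominus>\<^bsub>N\<^esub> q))"
      using q x' \<iota>_in Q_in by (simp add: N.minus_eq N.a_ac)
    also have "\<dots> = q' \<ominus>\<^bsub>N\<^esub> q"
      using q x' \<iota>_in Q_in by (simp add: N.r_neg2)
    finally have "\<iota> x \<ominus>\<^bsub>N\<^esub> \<iota> x' \<in> P \<inter> Q"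
      using x q x' \<iota>_in P_closed(3)[of "\<iota> x" "\<ominus>\<^bsub>N\<^esub> \<iota> x'"] P_closed(4)[of "\<iota> x'"]
        Q_closed(3)[of q' "\<ominus>\<^bsub>N\<^esub> q"] Q_closed(4)[of q] by (simp add: N.minus_eq)
    then have "\<iota> x = \<iota> x'"
      using x x' \<iota>_in PQ(1) N.minus_eq N.minus_equality[of "\<iota> x" "\<ominus>\<^bsub>N\<^esub> \<iota> x'"] by simp
    then show "x' = x"
      using bij x x' by (auto simp: bij_betw_def inj_on_def)
  qed (use x q in auto)
  have decomp: "\<exists>x\<in>carrier M. \<exists>q\<in>Q. v = \<iota> x \<oplus>\<^bsub>N\<^esub> q" if "v \<in> carrier N" for v
  proof -
    from that obtain p q where "p \<in> P" "q \<in> Q" "v = p \<oplus>\<^bsub>N\<^esub> q"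
      unfolding PQ(2)[symmetric] by (auto simp: set_add_def set_mult_def)
    with bij show ?thesis by (auto simp: bij_betw_def)
  qed
  show ?thesis
  proof (rule that)
    show "\<iota> \<in> bimodule_hom L R M N"
      using \<iota>_in(2) \<iota>_hom by (auto simp: bimodule_hom_def)
    show "\<pi> (\<iota> x) = x" if "x \<in> carrier M" for x
      using \<pi>[OF that Q_closed(2)] \<iota>_in(2)[OF that] by simp
    show "\<pi> \<in> bimodule_hom L R N M"
      unfolding bimodule_hom_def
    proof (intro CollectI conjI ballI Pi_I)
      fix v assume "v \<in> carrier N"
      then obtain x q where v: "x \<in> carrier M" "q \<in> Q" "v = \<iota> x \<oplus>\<^bsub>N\<^esub> q"
        using decomp by blast
      then show "\<pi> v \<in> carrier M"
        using \<pi> by simp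
      \<comment> \<open>Acting on \<open>v\<close> componentwise yields again an element of the
        image of \<open>\<iota>\<close> plus an element of \<open>Q\<close>, so \<open>\<pi>\<close>
        can be read off.\<close>
      show "\<pi> (lact N a v) = lact M a (\<pi> v)" if "a \<in> carrier L" for a
        using v that \<pi>[of "lact M a x" "lact N a q"]
        by (simp add: \<iota>_hom \<pi> M_lact Q_closed \<iota>_in Q_in additive_map_add[OF N_lact])
      show "\<pi> (ract N v b) = ract M (\<pi> v) b" if "b \<in> carrier R" for b
        using v that \<pi>[of "ract M x b" "ract N q b"]
        by (simp add: \<iota>_hom \<pi> M_ract Q_closed \<iota>_in Q_in additive_map_add[OF N_ract])
      fix v' assume "v' \<in> carrier N"
      then obtain x' q' where v': "x' \<in> carrier M" "q' \<in> Q" "v' = \<iota> x' \<oplus>\<^bsub>N\<^esub> q'"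
        using decomp by blast
      have "v \<oplus>\<^bsub>N\<^esub> v' = \<iota> (x \<oplus>\<^bsub>M\<^esub> x') \<oplus>\<^bsub>N\<^esub> (q \<oplus>\<^bsub>N\<^esub> q')"
        using v v' \<iota>_in Q_in by (simp add: \<iota>_hom N.a_ac)
      then show "\<pi> (v \<oplus>\<^bsub>N\<^esub> v') = \<pi> v \<oplus>\<^bsub>M\<^esub> \<pi> v'"
        using v v' \<pi> Q_closed(3) by simp
    qed
  qed
qed

lemma bimodule_power_simps:
  "carrier (bimodule_power M n) = {..<n} \<rightarrow>\<^sub>E carrier M"
  "ring.zero (bimodule_power M n) = (\<lambda>i\<in>{..<n}. \<zero>\<^bsub>M\<^esub>)"
  "v \<oplus>\<^bsub>bimodule_power M n\<^esub> w = (\<lambda>i\<in>{..<n}. v i \<oplus>\<^bsub>M\<^esub> w i)"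
  "lact (bimodule_power M n) a v = (\<lambda>i\<in>{..<n}. lact M a (v i))"
  "ract (bimodule_power M n) v b = (\<lambda>i\<in>{..<n}. ract M (v i) b)"
  by (simp_all add: bimodule_power_def)

lemma abelian_group_power:
  assumes "abelian_group M"
  shows "abelian_group (bimodule_power M n)"
proof -
  interpret abelian_group M by fact
  show ?thesis
  proof (rule abelian_groupI)
    fix v assume v: "v \<in> carrier (bimodule_power M n)"
    show "\<exists>w\<in>carrier (bimodule_power M n).
        w \<oplus>\<^bsub>bimodule_power M n\<^esub> v = \<zero>\<^bsub>bimodule_power M n\<^esub>"
      by (rule bexI[of _ "\<lambda>i\<in>{..<n}. \<ominus>\<^bsub>M\<^esub> v i"])
        (use v in \<open>auto simp: bimodule_power_simps l_neg PiE_iff intro!: restrict_ext\<close>)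
    show "\<zero>\<^bsub>bimodule_power M n\<^esub> \<oplus>\<^bsub>bimodule_power M n\<^esub> v = v"
      using v by (auto simp: bimodule_power_simps PiE_iff extensional_def fun_eq_iff)
  qed (auto simp: bimodule_power_simps PiE_iff a_ac intro!: restrict_ext)
qed

lemma power_map_additive:
  assumes "f \<in> additive_maps M N"
  shows "(\<lambda>v. \<lambda>i\<in>{..<n}. f (v i)) \<in> additive_maps (bimodule_power M n) (bimodule_power N n)"
  using assms
  by (intro additive_mapI)
    (auto simp: bimodule_power_simps PiE_iff additive_map_closed additive_map_add intro!: restrict_ext)

section \<open>Depth two\<close>

context ring_extension
begin

text \<open>For a section \<open>\<iota>\<close> into the power of \<open>A\<close> and its
  retraction \<open>\<pi>\<close>, the generators are the images under \<open>\<pi>\<close> of the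
  standard basis, and the coefficients of \<open>p\<close> are the coordinates of
  \<open>\<iota> p\<close>.\<close>

lemma left_depth_two_generators:
  assumes "iso_to_direct_summand B A
      (tensor_square A B \<phi> \<phi> id) (bimodule_power (regular_bimodule A \<phi> id) n)"
  shows "\<exists>t f. (\<forall>i<n. t i \<in> carrier T) \<and>
    (\<forall>p\<in>carrier P. (\<forall>i<n. f p i \<in> carrier A) \<and> (\<Oplus>\<^bsub>P\<^esub>i\<in>{..<n}. t i \<lhd> f p i) = p)"
proof -
  let ?A = "regular_bimodule A \<phi> id" and ?N = "bimodule_power (regular_bimodule A \<phi> id) n"
  let ?S = "tensor_square A B \<phi> \<phi> id"
  have A_simps: "carrier ?A = carrier A" "ring.add ?A = ring.add A" "ring.zero ?A = ring.zero A"
    "lact ?A = (\<lambda>b a. \<phi> b \<otimes>\<^bsub>A\<^esub> a)" "ract ?A = (\<lambda>a b. a \<otimes>\<^bsub>A\<^esub> b)"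
    by (simp_all add: regular_bimodule_def)
  note N_simps = bimodule_power_simps A_simps
  have A: "abelian_group ?A"
    by (rule abelian_group_cong[OF A.abelian_group_axioms A_simps(1-3)])
  have N: "abelian_group ?N"
    by (rule abelian_group_power[OF A])
  have S_simps: "carrier ?S = carrier P" "ring.add ?S = ring.add P" "ring.zero ?S = ring.zero P"
    by (simp_all only: square_simps P_simps)
  have S: "abelian_group ?S"
    by (rule abelian_group_cong[OF abelian_group_square S_simps])
  have A_maps: "additive_maps ?A ?A = additive_maps A A"
    by (rule additive_maps_cong) (rule A_simps)+
  obtain \<iota> \<pi> where \<iota>: "\<iota> \<in> bimodule_hom B A ?S ?N" and \<pi>: "\<pi> \<in> bimodule_hom B A ?N ?S"
    and \<pi>\<iota>: "\<And>p. p \<in> carrier ?S \<Longrightarrow> \<pi> (\<iota> p) = p"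
  proof (rule direct_summand_retraction[OF assms S N])
    show "lact ?N b \<in> additive_maps ?N ?N" if "b \<in> carrier B" for b
      using power_map_additive[of "\<lambda>x. \<phi> b \<otimes>\<^bsub>A\<^esub> x" ?A ?A n] mult_additive(1)[of "\<phi> b"] that
      by (simp add: A_maps N_simps(4,9) bimodule_power_def)
    show "(\<lambda>v. ract ?N v a) \<in> additive_maps ?N ?N" if "a \<in> carrier A" for a
      using power_map_additive[of "\<lambda>x. x \<otimes>\<^bsub>A\<^esub> a" ?A ?A n] mult_additive(2)[of a] that
      by (simp add: A_maps N_simps(5,10))
  qed (simp_all add: S_simps square_actions)
  \<comment> \<open>The standard basis vectors of the \<open>n\<close>-th power of
    \<open>A\<close>.\<close>
  define e where "e i = (\<lambda>j\<in>{..<n}. if i = j then \<one>\<^bsub>A\<^esub> else \<zero>\<^bsub>A\<^esub>)" for i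
  have e: "e i \<in> carrier ?N" for i
    by (auto simp: N_simps e_def)
  have \<pi>_lact: "\<pi> (lact ?N b v) = \<phi> b \<rhd> \<pi> v" if "b \<in> carrier B" "v \<in> carrier ?N" for b v
    using \<pi> that by (auto simp: bimodule_hom_def square_actions)
  have \<pi>_ract: "\<pi> (ract ?N v a) = \<pi> v \<lhd> a" if "a \<in> carrier A" "v \<in> carrier ?N" for a v
    using \<pi> that by (auto simp: bimodule_hom_def square_actions)
  have \<pi>_closed: "\<pi> v \<in> carrier P" if "v \<in> carrier ?N" for v
    using \<pi> that by (auto simp: bimodule_hom_def S_simps)
  have \<pi>_additive: "\<pi> \<in> additive_maps ?N P"
    using \<pi> by (intro additive_mapI \<pi>_closed) (auto simp: bimodule_hom_def S_simps)
  have \<iota>_closed: "\<iota> p i \<in> carrier A" if "p \<in> carrier P" "i < n" for p i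
    using \<iota> that by (auto simp: bimodule_hom_def S_simps N_simps)
  have summand: "ract ?N (e i) (\<iota> p i) \<in> carrier ?N" if "p \<in> carrier P" "i < n" for p i
    using e[of i] that \<iota>_closed by (auto simp: N_simps)
  show ?thesis
  proof (intro exI conjI ballI allI impI)
    show "\<pi> (e i) \<in> carrier T" for i
      unfolding carrier_T
    proof (intro CollectI conjI ballI \<pi>_closed e)
      fix b assume b: "b \<in> carrier B"
      \<comment> \<open>Both sides have \<open>\<phi> b\<close> at position \<open>i\<close> and
        zero elsewhere. As \<open>\<pi>\<close> is linear over \<open>B\<close> on the left and
        \<open>A\<close> on the right, this makes \<open>\<pi> (e i)\<close> invariant.\<close>
      have "lact ?N b (e i) = ract ?N (e i) (\<phi> b)"
        using b by (auto simp: N_simps e_def intro!: restrict_ext)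
      then show "\<phi> b \<rhd> \<pi> (e i) = \<pi> (e i) \<lhd> \<phi> b"
        using b e by (metis \<pi>_lact \<pi>_ract phi_closed)
    qed
    show "\<iota> p i \<in> carrier A" if "p \<in> carrier P" "i < n" for p i
      using \<iota>_closed that .
    fix p assume p: "p \<in> carrier P"
    have \<iota>p: "\<iota> p \<in> carrier ?N"
      using \<iota> p by (auto simp: bimodule_hom_def S_simps)
    \<comment> \<open>Expansion in the standard basis with coefficients on the right, compared
      coordinate by coordinate.\<close>
    have "\<iota> p = (\<Oplus>\<^bsub>?N\<^esub>i\<in>{..<n}. ract ?N (e i) (\<iota> p i))" (is "_ = ?s")
    proof (rule PiE_ext)
      show "\<iota> p \<in> {..<n} \<rightarrow>\<^sub>E carrier A"
        using \<iota>p by (simp add: N_simps)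
      have "?s \<in> carrier ?N"
        by (intro abelian_monoid.finsum_closed[OF abelian_group.axioms(1)[OF N]] Pi_I summand[OF p]) simp
      then show "?s \<in> {..<n} \<rightarrow>\<^sub>E carrier A"
        by (simp add: N_simps)
      fix j assume j: "j \<in> {..<n}"
      then have eval: "(\<lambda>v. v j) \<in> additive_maps ?N A"
        by (intro additive_mapI) (auto simp: N_simps)
      have "?s j = (\<Oplus>\<^bsub>A\<^esub>i\<in>{..<n}. ract ?N (e i) (\<iota> p i) j)"
        by (rule additive_map_finsum[OF N A.abelian_group_axioms eval]) (use summand[OF p] in auto)
      also have "\<dots> = (\<Oplus>\<^bsub>A\<^esub>i\<in>{..<n}. if j = i then \<iota> p i else \<zero>\<^bsub>A\<^esub>)"
        by (rule A.finsum_cong') (use j \<iota>_closed[OF p] in \<open>auto simp: N_simps e_def\<close>)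
      also have "\<dots> = \<iota> p j"
        using j \<iota>_closed[OF p] by (intro A.finsum_singleton) auto
      finally show "\<iota> p j = ?s j" ..
    qed
    then have "p = \<pi> ?s"
      using \<pi>\<iota> p by (simp add: S_simps)
    also have "\<dots> = (\<Oplus>\<^bsub>P\<^esub>i\<in>{..<n}. \<pi> (ract ?N (e i) (\<iota> p i)))"
      by (rule additive_map_finsum[OF N abelian_group_square \<pi>_additive])
        (use summand[OF p] in auto)
    also have "\<dots> = (\<Oplus>\<^bsub>P\<^esub>i\<in>{..<n}. \<pi> (e i) \<lhd> \<iota> p i)"
      by (rule P.finsum_cong') (use \<pi>_ract e \<pi>_closed \<iota>_closed[OF p] in auto)
    finally show "(\<Oplus>\<^bsub>P\<^esub>i\<in>{..<n}. \<pi> (e i) \<lhd> \<iota> p i) = p" ..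
  qed
qed

text \<open>By left depth two, \<open>T\<close> generates \<open>A \<otimes>\<^sub>B A\<close> as a right \<open>A\<close>-module.\<close>

lemma depth_two_ext:
  assumes "depth_two A B \<phi>" and G: "abelian_group G"
    and f: "f \<in> additive_maps P G" and g: "g \<in> additive_maps P G"
    and eq: "\<And>t a. t \<in> carrier T \<Longrightarrow> a \<in> carrier A \<Longrightarrow> f (t \<lhd> a) = g (t \<lhd> a)"
    and p: "p \<in> carrier P"
  shows "f p = g p"
proof -
  interpret G: abelian_group G by fact
  obtain n where "iso_to_direct_summand B A
      (tensor_square A B \<phi> \<phi> id) (bimodule_power (regular_bimodule A \<phi> id) n)"
    using assms(1) by (auto simp: depth_two_def)
  from left_depth_two_generators[OF this] obtain t c where t: "\<And>i. i < n \<Longrightarrow> t i \<in> carrier T"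
    and gen: "\<forall>p\<in>carrier P. (\<forall>i<n. c p i \<in> carrier A) \<and> (\<Oplus>\<^bsub>P\<^esub>i\<in>{..<n}. t i \<lhd> c p i) = p"
    by (elim exE conjE) (rule that, blast+)
  have c: "c p i \<in> carrier A" if "i < n" for i
    using gen p that by blast
  have sum: "(\<Oplus>\<^bsub>P\<^esub>i\<in>{..<n}. t i \<lhd> c p i) = p"
    using gen p by blast
  have in_P: "(\<lambda>i. t i \<lhd> c p i) \<in> {..<n} \<rightarrow> carrier P"
    using t c by (simp add: Pi_def T_in_square)
  note push = additive_map_finsum[OF abelian_group_square G _ finite_lessThan in_P]
  have "f p = (\<Oplus>\<^bsub>G\<^esub>i\<in>{..<n}. f (t i \<lhd> c p i))"
    using sum push[OF f] by simp
  also have "\<dots> = (\<Oplus>\<^bsub>G\<^esub>i\<in>{..<n}. g (t i \<lhd> c p i))"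
    by (rule G.finsum_cong') (use eq t c in \<open>auto simp: T_in_square intro!: additive_map_closed[OF g]\<close>)
  also have "\<dots> = g p"
    using sum push[OF g] by simp
  finally show ?thesis .
qed

text \<open>Balancing moves \<open>\<phi> b\<close> to the second factor, where it commutes with
  \<open>r\<close>. Such elements carry the unit of \<open>R\<close> to any prescribed
  \<open>r\<close>.\<close>

lemma one_pure_in_T:
  assumes "r \<in> carrier R"
  shows "\<one>\<^bsub>A\<^esub> \<odot> r \<in> carrier T"
proof -
  have "\<phi> b \<odot> r = \<one>\<^bsub>A\<^esub> \<odot> (r \<otimes>\<^bsub>A\<^esub> \<phi> b)" if "b \<in> carrier B" for b
    using square.elem_balanced[of "\<one>\<^bsub>A\<^esub>" b r] that assms R_commutes[OF assms that]
    by (simp add: R_in_A)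
  then show ?thesis
    using assms by (simp add: carrier_T R_in_A)
qed

section \<open>The bimodule isomorphism onto \<open>A\<close>\<close>

abbreviation pure_CT (infixl \<open>\<odot>\<^sub>T\<close> 68) where "r \<odot>\<^sub>T p \<equiv> CT.pure r p"

lemma CT_collapse:
  assumes d2: "depth_two A B \<phi>" and r: "r \<in> carrier R" and p: "p \<in> carrier P"
  shows "r \<odot>\<^sub>T p = \<one>\<^bsub>A\<^esub> \<odot>\<^sub>T (\<one>\<^bsub>A\<^esub> \<odot> T_ract A r p)"
proof -
  have unit: "s \<odot>\<^sub>T (\<one>\<^bsub>A\<^esub> \<odot> a) = \<one>\<^bsub>A\<^esub> \<odot>\<^sub>T (\<one>\<^bsub>A\<^esub> \<odot> (s \<otimes>\<^bsub>A\<^esub> a))"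
    if "s \<in> carrier R" "a \<in> carrier A" for s a
    using CT.elem_balanced[OF one_R one_pure_in_T[OF that(1)], of "\<one>\<^bsub>A\<^esub> \<odot> a"] that
    by (simp add: T_ract_pure one_R R_in_A T_lact_pure one_pure_in_T)
  have left: "(\<lambda>p. s \<odot>\<^sub>T p) \<in> additive_maps P CT.tensor" if "s \<in> carrier R" for s
    using that by (intro additive_mapI CT.elem_closed CT.elem_add_right)
  have right: "(\<lambda>a. \<one>\<^bsub>A\<^esub> \<odot> a) \<in> additive_maps A P"
    by (intro additive_mapI) (simp_all add: pure_add_right)
  show ?thesis
  proof (rule depth_two_ext[OF d2 CT.abelian_group_tensor left[OF r]
      additive_map_comp[OF additive_map_comp[OF T_ract_additive[OF r] right] left[OF one_R]] _ p])
    fix t a assume t: "t \<in> carrier T" and a: "a \<in> carrier A"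
    have "r \<odot>\<^sub>T (t \<lhd> a) = T_ract A r t \<odot>\<^sub>T (\<one>\<^bsub>A\<^esub> \<odot> a)"
      using CT.elem_balanced[OF r t, of "\<one>\<^bsub>A\<^esub> \<odot> a"] t a
      by (simp add: T_lact_pure lact_one T_in_square)
    also have "\<dots> = \<one>\<^bsub>A\<^esub> \<odot>\<^sub>T (\<one>\<^bsub>A\<^esub> \<odot> T_ract A r (t \<lhd> a))"
      using r t a by (simp add: unit T_ract_in_R T_ract_bilinear T_in_square)
    finally show "r \<odot>\<^sub>T (t \<lhd> a) = \<one>\<^bsub>A\<^esub> \<odot>\<^sub>T (\<one>\<^bsub>A\<^esub> \<odot> T_ract A r (t \<lhd> a))" .
  qed
qed

lemma centralizer_tensor_simps:
  "carrier (centralizer_tensor A B \<phi>) = carrier CT.tensor"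
  "ring.add (centralizer_tensor A B \<phi>) = ring.add CT.tensor"
  "lact (centralizer_tensor A B \<phi>) a = tensor_map T R (T_ract A) P (T_lact A B \<phi>) id (lact P a)"
  "ract (centralizer_tensor A B \<phi>) q a =
    tensor_map T R (T_ract A) P (T_lact A B \<phi>) id (\<lambda>p. p \<lhd> a) q"
  by (simp_all add: centralizer_tensor_def Let_def P_def)

lemma centralizer_tensor_iso:
  assumes d2: "depth_two A B \<phi>"
  shows "bimodule_isomorphic A A (centralizer_tensor A B \<phi>) (regular_bimodule A id id)"
proof -
  let ?f = "tensor_lift A (T_ract A)"
  note f_add = CT.tensor_lift_additive[OF A.abelian_group_axioms balanced_T_ract]
  note f_pure = CT.tensor_lift_elem[OF A.abelian_group_axioms balanced_T_ract]
  have id: "id \<in> additive_maps R R"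
    by (simp add: additive_mapI)
  \<comment> \<open>The outer actions of \<open>A\<close> respect the balancing over
    \<open>T\<close>, since they commute with the action of \<open>T\<close> on
    \<open>P\<close>.\<close>
  have l: "r \<odot>\<^sub>T (a \<rhd> T_lact A B \<phi> t p) = T_ract A r t \<odot>\<^sub>T (a \<rhd> p)"
    "r \<odot>\<^sub>T (T_lact A B \<phi> t p \<lhd> a) = T_ract A r t \<odot>\<^sub>T (p \<lhd> a)"
    if "r \<in> carrier R" "t \<in> carrier T" "p \<in> carrier P" "a \<in> carrier A" for r t p a
    using that CT.elem_balanced[of r t] by (simp_all flip: T_lact_bilinear)
  have lact: "?f (lact (centralizer_tensor A B \<phi>) a q) = a \<otimes>\<^bsub>A\<^esub> ?f q"
    and ract: "?f (ract (centralizer_tensor A B \<phi>) q a) = ?f q \<otimes>\<^bsub>A\<^esub> a"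
    if a: "a \<in> carrier A" and q: "q \<in> carrier CT.tensor" for a q
  proof -
    have bal: "id (T_ract A r t) \<odot>\<^sub>T (a \<rhd> p) = id r \<odot>\<^sub>T (a \<rhd> T_lact A B \<phi> t p)"
      "id (T_ract A r t) \<odot>\<^sub>T (p \<lhd> a) = id r \<odot>\<^sub>T (T_lact A B \<phi> t p \<lhd> a)"
      if "r \<in> carrier R" "t \<in> carrier T" "p \<in> carrier P" for r t p
      using l that a by simp_all
    note ml = CT.tensor_map_additive[OF id lact_additive[OF a]] CT.tensor_map_elem[OF id lact_additive[OF a]]
    note mr = CT.tensor_map_additive[OF id ract_additive[OF a]] CT.tensor_map_elem[OF id ract_additive[OF a]]
    have ml: "lact (centralizer_tensor A B \<phi>) a \<in> additive_maps CT.tensor CT.tensor"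
      "r \<in> carrier R \<Longrightarrow> p \<in> carrier P \<Longrightarrow>
        lact (centralizer_tensor A B \<phi>) a (r \<odot>\<^sub>T p) = r \<odot>\<^sub>T (a \<rhd> p)" for r p
      unfolding centralizer_tensor_simps using ml bal(1) by auto
    have mr: "(\<lambda>q. ract (centralizer_tensor A B \<phi>) q a) \<in> additive_maps CT.tensor CT.tensor"
      "r \<in> carrier R \<Longrightarrow> p \<in> carrier P \<Longrightarrow>
        ract (centralizer_tensor A B \<phi>) (r \<odot>\<^sub>T p) a = r \<odot>\<^sub>T (p \<lhd> a)" for r p
      unfolding centralizer_tensor_simps using mr bal(2) by auto
    show "?f (lact (centralizer_tensor A B \<phi>) a q) = a \<otimes>\<^bsub>A\<^esub> ?f q"
      by (rule CT.tensor_ext[OF A.abelian_group_axioms additive_map_comp[OF ml(1) f_add]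
            additive_map_comp[OF f_add mult_additive(1)[OF a]] _ q])
        (use a in \<open>simp add: ml(2) f_pure T_ract_bilinear\<close>)
    show "?f (ract (centralizer_tensor A B \<phi>) q a) = ?f q \<otimes>\<^bsub>A\<^esub> a"
      by (rule CT.tensor_ext[OF A.abelian_group_axioms additive_map_comp[OF mr(1) f_add]
            additive_map_comp[OF f_add mult_additive(2)[OF a]] _ q])
        (use a in \<open>simp add: mr(2) f_pure T_ract_bilinear\<close>)
  qed
  \<comment> \<open>The candidate inverse. It only has to be additive, because
    \<open>bimodule_isomorphic\<close> asks for linearity in one direction together with
    bijectivity.\<close>
  let ?g = "\<lambda>a. \<one>\<^bsub>A\<^esub> \<odot>\<^sub>T (\<one>\<^bsub>A\<^esub> \<odot> a)"
  have g: "?g \<in> additive_maps A CT.tensor"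
    by (intro additive_mapI CT.elem_closed)
      (simp_all add: one_R pure_add_right CT.elem_add_right)
  have "bij_betw ?f (carrier CT.tensor) (carrier A)"
  proof (rule bij_betw_byWitness[where f' = ?g])
    show "\<forall>q\<in>carrier CT.tensor. ?g (?f q) = q"
    proof
      fix q assume q: "q \<in> carrier CT.tensor"
      show "?g (?f q) = q"
        by (rule CT.tensor_ext[OF CT.abelian_group_tensor additive_map_comp[OF f_add g] _ _ q])
          (simp_all add: additive_mapI f_pure CT_collapse[OF d2, symmetric])
    qed
    show "\<forall>a\<in>carrier A. ?f (?g a) = a"
      by (simp add: f_pure one_R T_ract_pure)
  qed (use additive_map_closed[OF f_add] additive_map_closed[OF g] in auto)
  moreover have "?f \<in> bimodule_hom A A (centralizer_tensor A B \<phi>) (regular_bimodule A id id)"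
    using additive_map_closed[OF f_add] additive_map_add[OF f_add] lact ract
    by (simp add: bimodule_hom_def centralizer_tensor_simps(1,2) regular_bimodule_def)
  ultimately show ?thesis
    unfolding bimodule_isomorphic_def
    by (auto simp: centralizer_tensor_simps(1) regular_bimodule_def)
qed

section \<open>Endomorphisms of \<open>R\<close> over \<open>T\<close> and the center of
  \<open>A\<close>\<close>

abbreviation "E \<equiv> right_module_End T R (T_ract A)"

lemma carrier_E:
  "f \<in> carrier E \<longleftrightarrow> f \<in> carrier R \<rightarrow>\<^sub>E carrier R \<and>
    (\<forall>x\<in>carrier R. \<forall>y\<in>carrier R. f (x \<oplus>\<^bsub>A\<^esub> y) = f x \<oplus>\<^bsub>A\<^esub> f y) \<and>
    (\<forall>x\<in>carrier R. \<forall>t\<in>carrier T. f (T_ract A x t) = T_ract A (f x) t)"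
  by (simp add: right_module_End_def)

lemma E_eval:
  assumes "f \<in> carrier E" "r \<in> carrier R"
  shows "f r = f \<one>\<^bsub>A\<^esub> \<otimes>\<^bsub>A\<^esub> r"
proof -
  have f1: "f \<one>\<^bsub>A\<^esub> \<in> carrier R"
    using assms(1) one_R by (auto simp: carrier_E)
  have "f (T_ract A \<one>\<^bsub>A\<^esub> (\<one>\<^bsub>A\<^esub> \<odot> r)) = T_ract A (f \<one>\<^bsub>A\<^esub>) (\<one>\<^bsub>A\<^esub> \<odot> r)"
    using assms one_R one_pure_in_T by (auto simp: carrier_E)
  then show ?thesis
    using assms(2) f1 by (simp add: T_ract_pure one_R R_in_A)
qed

text \<open>Linearity of \<open>f\<close> gives an identity for elements of \<open>T\<close> only.
  Right multiplication by \<open>A\<close> and depth two extend it to all of \<open>P\<close>, where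
  it can be tested on tensors outside \<open>T\<close>.\<close>

lemma E_one_central:
  assumes "depth_two A B \<phi>" "f \<in> carrier E" "a \<in> carrier A"
  shows "f \<one>\<^bsub>A\<^esub> \<otimes>\<^bsub>A\<^esub> a = a \<otimes>\<^bsub>A\<^esub> f \<one>\<^bsub>A\<^esub>"
proof -
  have f1: "f \<one>\<^bsub>A\<^esub> \<in> carrier R" "f \<one>\<^bsub>A\<^esub> \<in> carrier A"
    using assms(2) one_R R_in_A by (auto simp: carrier_E)
  have "T_ract A (f \<one>\<^bsub>A\<^esub>) p = f \<one>\<^bsub>A\<^esub> \<otimes>\<^bsub>A\<^esub> T_ract A \<one>\<^bsub>A\<^esub> p" if "p \<in> carrier P" for p
  proof (rule depth_two_ext[OF assms(1) A.abelian_group_axioms T_ract_additive[OF f1(1)]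
      additive_map_comp[OF T_ract_additive[OF one_R] mult_additive(1)[OF f1(2)]] _ that])
    fix t a assume t: "t \<in> carrier T" and a: "a \<in> carrier A"
    have "T_ract A (f \<one>\<^bsub>A\<^esub>) t = f (T_ract A \<one>\<^bsub>A\<^esub> t)"
      using assms(2) one_R t by (auto simp: carrier_E)
    also have "\<dots> = f \<one>\<^bsub>A\<^esub> \<otimes>\<^bsub>A\<^esub> T_ract A \<one>\<^bsub>A\<^esub> t"
      by (rule E_eval[OF assms(2) T_ract_in_R[OF one_R t]])
    finally show "T_ract A (f \<one>\<^bsub>A\<^esub>) (t \<lhd> a) = f \<one>\<^bsub>A\<^esub> \<otimes>\<^bsub>A\<^esub> T_ract A \<one>\<^bsub>A\<^esub> (t \<lhd> a)"
      using f1 t a by (simp add: T_ract_bilinear T_in_square one_R T_ract_closed A.m_assoc)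
  qed
  from this[of "a \<odot> \<one>\<^bsub>A\<^esub>"] show ?thesis
    using assms(3) f1 by (simp add: T_ract_pure one_R)
qed

text \<open>The isomorphism is evaluation at the unit, and its inverse sends a central element to
  left multiplication by it.\<close>

lemma centralizer_End_iso:
  assumes d2: "depth_two A B \<phi>"
  shows "E \<simeq> ring_center A"
proof -
  let ?Z = "ring_center A" and ?ev = "\<lambda>f. f \<one>\<^bsub>A\<^esub>"
  have Z: "z \<in> carrier ?Z \<longleftrightarrow> z \<in> carrier A \<and> (\<forall>a\<in>carrier A. z \<otimes>\<^bsub>A\<^esub> a = a \<otimes>\<^bsub>A\<^esub> z)" for z
    by (simp add: ring_center_def)
  have E_in_R: "f r \<in> carrier R" if "f \<in> carrier E" "r \<in> carrier R" for f r
    using that by (auto simp: carrier_E)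
  have ev: "?ev f \<in> carrier ?Z" if "f \<in> carrier E" for f
    using that E_one_central[OF d2 that] E_in_R[OF that one_R] by (auto simp: Z R_in_A)
  have inv: "(\<lambda>r\<in>carrier R. z \<otimes>\<^bsub>A\<^esub> r) \<in> carrier E" if z: "z \<in> carrier ?Z" for z
  proof -
    have zA: "z \<in> carrier A" and zc: "\<And>a. a \<in> carrier A \<Longrightarrow> z \<otimes>\<^bsub>A\<^esub> a = a \<otimes>\<^bsub>A\<^esub> z"
      using z by (auto simp: Z)
    have zR: "z \<otimes>\<^bsub>A\<^esub> r \<in> carrier R" if r: "r \<in> carrier R" for r
    proof -
      have "\<phi> b \<otimes>\<^bsub>A\<^esub> (z \<otimes>\<^bsub>A\<^esub> r) = z \<otimes>\<^bsub>A\<^esub> r \<otimes>\<^bsub>A\<^esub> \<phi> b" if "b \<in> carrier B" for b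
        using zA r that by (metis A.m_assoc R_commutes R_in_A phi_closed zc)
      then show ?thesis using zA r by (simp add: carrier_R)
    qed
    have "T_ract A (z \<otimes>\<^bsub>A\<^esub> r) p = z \<otimes>\<^bsub>A\<^esub> T_ract A r p" if r: "r \<in> carrier R" and p: "p \<in> carrier P" for r p
    proof (rule square_ext[OF A.abelian_group_axioms T_ract_additive[OF zR[OF r]]
        additive_map_comp[OF T_ract_additive[OF r] mult_additive(1)[OF zA]] _ p])
      fix x y assume "x \<in> carrier A" "y \<in> carrier A"
      then show "T_ract A (z \<otimes>\<^bsub>A\<^esub> r) (x \<odot> y) = z \<otimes>\<^bsub>A\<^esub> T_ract A r (x \<odot> y)"
        using r zA zR by (simp add: T_ract_pure R_in_A zc[of x] flip: A.m_assoc)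
    qed
    then show ?thesis
      using zA zR abelian_groupE(1)[OF abelian_group_R]
      by (auto simp: carrier_E T_in_square T_ract_in_R A.r_distr R_in_A)
  qed
  have "bij_betw ?ev (carrier E) (carrier ?Z)"
  proof (rule bij_betw_byWitness[where f' = "\<lambda>z. \<lambda>r\<in>carrier R. z \<otimes>\<^bsub>A\<^esub> r"])
    show "\<forall>f\<in>carrier E. (\<lambda>r\<in>carrier R. ?ev f \<otimes>\<^bsub>A\<^esub> r) = f"
    proof
      fix f assume f: "f \<in> carrier E"
      \<comment> \<open>\<open>E_eval\<close> determines \<open>f\<close> on \<open>R\<close>;
        extensionality settles equality outside \<open>R\<close>.\<close>
      then have "f \<in> extensional (carrier R)"
        by (auto simp: carrier_E PiE_iff)
      then show "(\<lambda>r\<in>carrier R. ?ev f \<otimes>\<^bsub>A\<^esub> r) = f"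
        using E_eval[OF f] by (auto simp: fun_eq_iff extensional_def)
    qed
  qed (use ev inv one_R in \<open>auto simp: Z\<close>)
  moreover have "?ev \<in> ring_hom E ?Z"
  proof (rule ring_hom_memI)
    fix f g assume f: "f \<in> carrier E" and g: "g \<in> carrier E"
    show "?ev (f \<otimes>\<^bsub>E\<^esub> g) = ?ev f \<otimes>\<^bsub>?Z\<^esub> ?ev g"
      using E_eval[OF f E_in_R[OF g one_R]] one_R
      by (simp add: right_module_End_def ring_center_def compose_def)
    show "?ev (f \<oplus>\<^bsub>E\<^esub> g) = ?ev f \<oplus>\<^bsub>?Z\<^esub> ?ev g"
      using one_R by (simp add: right_module_End_def ring_center_def)
  qed (use ev one_R in \<open>auto simp: right_module_End_def ring_center_def\<close>)
  ultimately show ?thesis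
    by (auto simp: is_ring_iso_def ring_iso_def)
qed

end

theorem theorem2p4:
  fixes A :: "('a, 'x) ring_scheme" and B :: "('b, 'y) ring_scheme" and \<phi> :: "'b \<Rightarrow> 'a"
  assumes "ring_extension A B \<phi>" and "depth_two A B \<phi>"
  shows "bimodule_isomorphic A A (centralizer_tensor A B \<phi>) (regular_bimodule A id id) \<and>
    right_module_End (T_ring A B \<phi>) (centralizer A B \<phi>) (T_ract A) \<simeq> ring_center A"
proof -
  interpret ring_extension A B \<phi> by fact
  show ?thesis
    using centralizer_tensor_iso centralizer_End_iso assms(2) by blast
qed

end
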